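(* Let $\phi\in(-1,1)$ and let $(Y_n)_{n\in\mathbb{N}}$ be the MA(1) process $Y_n=\varepsilon_n+\phi\,\varepsilon_{n-1}$, $n\in\mathbb{N}$, where $(\varepsilon_n)_{n\geq0}$ are i.i.d. $\mathcal{N}(0,1)$. Then the sequence of quadratic means $\left(\frac1n\sum_{k=1}^nY_k^2\right)_{n\in\mathbb{N}}$ satisfies a large deviation principle (with speed $n$) in $\mathbb{R}$ with good rate function $K_\phi$ given by $$K_\phi(x)=x\lambda_\phi(x)+\frac12\log\left[\frac{1-2\lambda_\phi(x)(1+\phi^2)+\sqrt{(1-2\lambda_\phi(x)(1+\phi^2))^2-16\lambda_\phi(x)^2\phi^2}}{2}\right]\quad\text{for all }x>0,$$ and $K_\phi(x)=\infty$ for $x\leq0$, where $\lambda_\phi(x)$ is the explicit real-valued function defined in the context.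
   Context: For $x>0$ define $$A_\phi(x)=4x\left(x(\phi^2+1)-(\phi^2-1)^2\right),$$ $$B_\phi(x)=4x^2\left(x^2(\phi^4+14\phi^2+1)+4x(\phi^2+1)(\phi^2-1)^2+(\phi^2-1)^4\right),$$ $$\begin{aligned}c_\phi(x)=-x^8(\phi^2-1)^4\Big(&4x^4\phi^2+32x^3(\phi^4+\phi^2)+x^2(\phi^4+46\phi^2+1)(\phi^2-1)^2\\&+6x(\phi^2+1)(\phi^2-1)^4+(\phi^2-1)^6\Big),\end{aligned}$$ $$\begin{aligned}C_\phi(x)=-(1+i\sqrt3)\Big[&-x^6(\phi^6-33\phi^4-33\phi^2+1)-6x^5(\phi^2-1)^2(\phi^4-10\phi^2+1)\\&+6x^4(\phi^2-1)^4(\phi^2+1)+x^3(\phi^2-1)^6+3\sqrt3\sqrt{c_\phi(x)}\Big]^{1/3},\end{aligned}$$ where the complex square root and cube root are principal branches, and $$\lambda_\phi(x)=\frac{A_\phi(x)+\frac{B_\phi(x)}{C_\phi(x)}+C_\phi(x)}{12x^2(\phi^2-1)^2}$$ (which is a real number for $x>0$). A sequence of random variables $(V_n)$ satisfies a large deviation principle (LDP) with speed $n$ and rate function $J$ if $J:\mathbb{R}\to[0,\infty]$ is lower semicontinuous and (i) for every closed $F\subset\mathbb{R}$, $\limsup_{n\to\infty}\frac1n\log\mathbb{P}(V_n\in F)\leq-\inf_{x\in F}J(x)$; (ii) for every open $G\subset\mathbb{R}$, $-\inf_{x\in G}J(x)\leq\liminf_{n\to\infty}\frac1n\log\mathbb{P}(V_n\in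 G)$. The rate function is good if its level sets $J^{-1}([0,b])$ are compact for all $b\in\mathbb{R}$. Here $\mathbb{N}=\{1,2,\dots\}$. *)

theory Defs
  imports "HOL-Probability.Probability"
begin

section \<open>Large deviation principles on the real line\<close>

definition elog :: "real \<Rightarrow> ereal" where
  "elog p = (if p \<le> 0 then - \<infinity> else ereal (ln p))"

definition lower_semicontinuous :: "(real \<Rightarrow> ereal) \<Rightarrow> bool" where
  "lower_semicontinuous J \<longleftrightarrow> (\<forall>x. J x \<le> Liminf (at x) J)"

text \<open>The values are in \<^typ>\<open>ereal\<close> rather than \<^typ>\<open>ennreal\<close>, so that nonnegativity is a claim
  and is not enforced by truncation.\<close>

definition rate_function :: "(real \<Rightarrow> ereal) \<Rightarrow> bool" where
  "rate_function J \<longleftrightarrow> (\<forall>x. 0 \<le> J x) \<and> lower_semicontinuous J"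

definition good_rate_function :: "(real \<Rightarrow> ereal) \<Rightarrow> bool" where
  "good_rate_function J \<longleftrightarrow> rate_function J \<and> (\<forall>b::real. compact {x. 0 \<le> J x \<and> J x \<le> ereal b})"

text \<open>Speed \<^term>\<open>n\<close>.  Sequences are indexed by \<open>n \<ge> 1\<close>; the entry at \<open>0\<close> plays no role.\<close>

definition satisfies_LDP ::
  "'a measure \<Rightarrow> (nat \<Rightarrow> 'a \<Rightarrow> real) \<Rightarrow> (real \<Rightarrow> ereal) \<Rightarrow> bool" where
  "satisfies_LDP M V J \<longleftrightarrow>
     (\<forall>n\<ge>1. V n \<in> borel_measurable M) \<and>
     rate_function J \<and>
     (\<forall>F. closed F \<longrightarrow>
        limsup (\<lambda>n. ereal (1 / real n) * elog (measure M {\<omega> \<in> space M. V n \<omega> \<in> F}))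
          \<le> - (INF x\<in>F. J x)) \<and>
     (\<forall>G. open G \<longrightarrow>
        - (INF x\<in>G. J x)
          \<le> liminf (\<lambda>n. ereal (1 / real n) * elog (measure M {\<omega> \<in> space M. V n \<omega> \<in> G})))"

section \<open>The explicit rate function\<close>

definition A_fun :: "real \<Rightarrow> real \<Rightarrow> real" where
  "A_fun \<phi> x = 4 * x * (x * (\<phi>^2 + 1) - (\<phi>^2 - 1)^2)"

definition B_fun :: "real \<Rightarrow> real \<Rightarrow> real" where
  "B_fun \<phi> x = 4 * x^2 *
     (x^2 * (\<phi>^4 + 14 * \<phi>^2 + 1) + 4 * x * (\<phi>^2 + 1) * (\<phi>^2 - 1)^2 + (\<phi>^2 - 1)^4)"

definition c_fun :: "real \<Rightarrow> real \<Rightarrow> real" where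
  "c_fun \<phi> x = - (x^8) * (\<phi>^2 - 1)^4 *
     (4 * x^4 * \<phi>^2 + 32 * x^3 * (\<phi>^4 + \<phi>^2) + x^2 * (\<phi>^4 + 46 * \<phi>^2 + 1) * (\<phi>^2 - 1)^2
      + 6 * x * (\<phi>^2 + 1) * (\<phi>^2 - 1)^4 + (\<phi>^2 - 1)^6)"

definition C_poly :: "real \<Rightarrow> real \<Rightarrow> real" where
  "C_poly \<phi> x = - (x^6) * (\<phi>^6 - 33 * \<phi>^4 - 33 * \<phi>^2 + 1)
     - 6 * x^5 * (\<phi>^2 - 1)^2 * (\<phi>^4 - 10 * \<phi>^2 + 1)
     + 6 * x^4 * (\<phi>^2 - 1)^4 * (\<phi>^2 + 1) + x^3 * (\<phi>^2 - 1)^6"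

text \<open>\<^const>\<open>csqrt\<close> is the principal square root, and the complex \<open>powr (1/3)\<close> is the principal
  cube root.\<close>

definition C_fun :: "real \<Rightarrow> real \<Rightarrow> complex" where
  "C_fun \<phi> x = - (1 + \<i> * of_real (sqrt 3)) *
     (of_real (C_poly \<phi> x) + 3 * of_real (sqrt 3) * csqrt (of_real (c_fun \<phi> x))) powr (1 / 3)"

definition lambda_complex :: "real \<Rightarrow> real \<Rightarrow> complex" where
  "lambda_complex \<phi> x =
     (of_real (A_fun \<phi> x) + of_real (B_fun \<phi> x) / C_fun \<phi> x + C_fun \<phi> x)
       / of_real (12 * x^2 * (\<phi>^2 - 1)^2)"

text \<open>Taking the real part loses nothing for \<open>x > 0\<close>: see \<open>lambda_complex_real\<close> below.\<close>

definition lambda_fun :: "real \<Rightarrow> real \<Rightarrow> real" where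
  "lambda_fun \<phi> x = Re (lambda_complex \<phi> x)"

definition K_fun :: "real \<Rightarrow> real \<Rightarrow> ereal" where
  "K_fun \<phi> x =
     (if x > 0 then
        ereal (x * lambda_fun \<phi> x + 1 / 2 *
          ln ((1 - 2 * lambda_fun \<phi> x * (1 + \<phi>^2)
               + sqrt ((1 - 2 * lambda_fun \<phi> x * (1 + \<phi>^2))^2 - 16 * (lambda_fun \<phi> x)^2 * \<phi>^2)) / 2))
      else \<infinity>)"

lemma c_fun_nonpos:
  assumes "x > 0"
  shows "c_fun \<phi> x \<le> 0"
proof -
  have "0 \<le> 4 * x^4 * \<phi>^2 + 32 * x^3 * (\<phi>^4 + \<phi>^2) + x^2 * (\<phi>^4 + 46 * \<phi>^2 + 1) * (\<phi>^2 - 1)^2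
      + 6 * x * (\<phi>^2 + 1) * (\<phi>^2 - 1)^4 + (\<phi>^2 - 1)^6"
    using assms by (intro add_nonneg_nonneg mult_nonneg_nonneg) auto
  then have "0 \<le> x^8 * (\<phi>^2 - 1)^4 *
     (4 * x^4 * \<phi>^2 + 32 * x^3 * (\<phi>^4 + \<phi>^2) + x^2 * (\<phi>^4 + 46 * \<phi>^2 + 1) * (\<phi>^2 - 1)^2
      + 6 * x * (\<phi>^2 + 1) * (\<phi>^2 - 1)^4 + (\<phi>^2 - 1)^6)"
    by (intro mult_nonneg_nonneg) auto
  then show ?thesis
    unfolding c_fun_def by simp
qed

lemma C_fun_discriminant: "(C_poly \<phi> x)^2 - 27 * c_fun \<phi> x = (B_fun \<phi> x / 4)^3"
  unfolding C_poly_def c_fun_def B_fun_def by algebra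

lemma C_fun_norm:
  assumes "x > 0"
  shows "(cmod (C_fun \<phi> x))^2 = B_fun \<phi> x"
proof -
  define z :: complex where
    "z = of_real (C_poly \<phi> x) + 3 * of_real (sqrt 3) * csqrt (of_real (c_fun \<phi> x))"
  have B: "0 \<le> B_fun \<phi> x / 4"
    unfolding B_fun_def using assms by auto
  have c: "c_fun \<phi> x \<le> 0"
    using assms by (rule c_fun_nonpos)
  have z: "z = Complex (C_poly \<phi> x) (3 * sqrt 3 * sqrt (- c_fun \<phi> x))"
    unfolding z_def using c by (simp add: csqrt_of_real_nonpos complex_eq_iff)
  have "(cmod z)^2 = (C_poly \<phi> x)^2 + (3 * sqrt 3 * sqrt (- c_fun \<phi> x))^2"
    unfolding z by (simp add: cmod_power2)
  also have "\<dots> = (B_fun \<phi> x / 4)^3"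
    using c by (simp add: power_mult_distrib C_fun_discriminant[symmetric])
  finally have nz: "(cmod z)^2 = (B_fun \<phi> x / 4)^3" .
  have "cmod (z powr (1/3)) = cmod z powr (1/3)"
    using norm_powr_real_powr'[of "1/3" z] by simp
  then have "(cmod (z powr (1/3)))^6 = ((cmod z powr (1/3))^3)^2"
    by (simp flip: power_mult)
  also have "(cmod z powr (1/3))^3 = cmod z"
    by (cases "z = 0") (simp_all add: powr_power)
  finally have "((cmod (z powr (1/3)))^2)^3 = (B_fun \<phi> x / 4)^3"
    using nz by (simp flip: power_mult)
  then have "(cmod (z powr (1/3)))^2 = B_fun \<phi> x / 4"
    using B by (subst (asm) power_eq_iff_eq_base) auto
  moreover have "(cmod (- (1 + \<i> * of_real (sqrt 3))))^2 = 4"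
    by (simp add: cmod_power2)
  ultimately show ?thesis
    unfolding C_fun_def z_def[symmetric] by (simp only: norm_mult power_mult_distrib)
qed

lemma lambda_complex_real:
  assumes "x > 0"
  shows "lambda_complex \<phi> x \<in> \<real>"
proof -
  have "of_real (B_fun \<phi> x) = C_fun \<phi> x * cnj (C_fun \<phi> x)"
    using C_fun_norm[OF assms, of \<phi>] complex_norm_square[of "C_fun \<phi> x"] by (metis of_real_power)
  then have "of_real (B_fun \<phi> x) / C_fun \<phi> x = cnj (C_fun \<phi> x)"
    by (cases "C_fun \<phi> x = 0") auto
  then have "of_real (B_fun \<phi> x) / C_fun \<phi> x + C_fun \<phi> x = of_real (2 * Re (C_fun \<phi> x))"
    by (simp add: complex_eq_iff)
  then show ?thesis
    unfolding lambda_complex_def add.assoc by (simp only:) (intro Reals_divide Reals_add Reals_of_real)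
qed

end

theory Submission
  imports Defs
begin

text \<open>
  The theorem is an instance of the Gaertner-Ellis principle in which everything can be computed in
  closed form.

  Write \<open>p = \<phi>\<^sup>2\<close>.  The limiting scaled cumulant generating function of the quadratic means is the
  integral of \<open>- 1/2 ln (1 - 2 l f)\<close> over the circle, where \<open>f = 1 + p + 2 \<phi> cos\<close> is the spectral
  density, that is \<open>cgf \<phi> l\<close>.  It is finite on the interval \<open>tilts \<phi>\<close> where \<open>1 - 2 l f\<close> is positive.
  Factoring this trigonometric polynomial removes the square root: every \<open>l\<close> in \<open>tilts \<phi>\<close> has the
  form \<open>l = \<kappa> s / 2 = tilt \<phi> s\<close> with \<open>\<kappa> = 1 / ((1 + s) (1 + s p))\<close>, \<open>s > -1\<close> and \<open>q = s\<^sup>2 p < 1\<close>, and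
  then \<open>1 - 2 l f = \<kappa> \<bar>1 - s \<phi> e\<^sup>i\<^sup>\<theta>\<bar>\<^sup>2\<close>.  In the parameter \<open>s\<close> the tilt, the limit \<open>cgf = ln ((1 + s) (1 + s p)) / 2\<close> and its slope \<open>mean \<phi> s\<close> are
  elementary, and the argument has three independent parts.

  \<^item> Probability.  Integrating out the noise variables one after the other keeps exponentials of
    quadratic functions inside that class, so that the moment generating function satisfies a Riccati
    recursion.  In terms of \<open>s\<close> the recursion has an explicit solution, and
    \<open>MA1_energy_mgf\<close> gives the exact value of the moment generating function for every sample size.

  \<^item> Large deviations.  \<open>Gaertner_Ellis\<close> is proved on the real line: exponential tilting gives the
    local lower bound, and Chernoff bounds for the two half-lines give the upper bound for closed
    sets.  The rate function is the Legendre transform of the limit.  That \<open>mean \<phi>\<close> takes every positive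
    value (\<open>mean_surj\<close>) is the steepness needed for the lower bound.

  \<^item> Algebra.  The Legendre transform at \<open>x = mean \<phi> s\<close> is attained at \<open>tilt \<phi> s\<close>.  Eliminating \<open>s\<close>
    shows that this tilt is a root of a cubic equation with three real roots.  The explicit
    \<open>lambda_fun\<close> is Cardano's formula for the middle root, and \<open>lambda_fun_mean\<close> verifies that the
    middle root is the right one.
\<close>

section \<open>The Gaertner-Ellis theorem on the real line\<close>

lemma elog_upper:
  assumes "1 \<le> n" "p \<le> exp (- (real n * c))"
  shows "ereal (1 / real n) * elog p \<le> ereal (- c)"
proof (cases "p \<le> 0")
  case False
  then have "ln p \<le> - (real n * c)"
    using assms(2) by (metis ln_exp ln_mono not_le)
  then show ?thesis
    using False assms(1) by (simp add: elog_def field_simps)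
qed (use assms in \<open>auto simp: elog_def\<close>)

lemma elog_lower:
  assumes "1 \<le> n" "exp (- (real n * c)) \<le> p"
  shows "ereal (- c) \<le> ereal (1 / real n) * elog p"
proof -
  have p: "0 < p"
    using assms(2) exp_gt_zero less_le_trans by blast
  then have "- (real n * c) \<le> ln p"
    using assms(2) by (simp add: ln_ge_iff)
  then show ?thesis
    using p assms(1) by (simp add: elog_def field_simps)
qed

lemma eventually_exp_decay:
  fixes g a :: real
  assumes "0 < g" "0 < a"
  shows "eventually (\<lambda>n. exp (- (real n * g)) \<le> a) sequentially"
proof -
  have "filterlim (\<lambda>n. real n * g) at_top sequentially"
    using assms by real_asymp
  then have "(\<lambda>n. exp (- (real n * g))) \<longlonglongrightarrow> 0"
    using filterlim_compose[OF exp_at_bot] by (auto simp: filterlim_uminus_at_top)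
  then have "eventually (\<lambda>n. exp (- (real n * g)) < a) sequentially"
    using assms(2) by (rule order_tendstoD)
  then show ?thesis
    by (rule eventually_mono) simp
qed

text \<open>The supremum is restricted to the set \<open>T\<close> on which the limit of the cumulant generating functions is known.\<close>
definition Legendre :: "real set \<Rightarrow> (real \<Rightarrow> real) \<Rightarrow> real \<Rightarrow> ereal" where
  "Legendre T L x = (SUP l\<in>T. ereal (l * x - L l))"

lemma lower_semicontinuous_Legendre: "lower_semicontinuous (Legendre T L)"
  unfolding lower_semicontinuous_def le_Liminf_iff
proof (intro allI impI)
  fix x y assume "y < Legendre T L x"
  then obtain l where l: "l \<in> T" "y < ereal (l * x - L l)"
    by (auto simp: Legendre_def less_SUP_iff)
  have "((\<lambda>z. ereal (l * z - L l)) \<longlongrightarrow> ereal (l * x - L l)) (at x)"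
    by (auto intro!: tendsto_intros)
  then have "eventually (\<lambda>z. y < ereal (l * z - L l)) (at x)"
    using l(2) by (rule order_tendstoD)
  then show "eventually (\<lambda>z. y < Legendre T L z) (at x)"
    by eventually_elim (use l(1) in \<open>auto simp: Legendre_def less_SUP_iff\<close>)
qed

text \<open>The proof of the upper bound and the form of the rate function use convexity of \<open>L\<close> only through
  \<open>tangent_below\<close>, which differentiability on \<open>T\<close> and the local lower bound imply.\<close>
locale scaled_cgf = prob_space M
  for M :: "'a measure" +
  fixes V :: "nat \<Rightarrow> 'a \<Rightarrow> real" and T :: "real set" and L D :: "real \<Rightarrow> real"
  assumes V [measurable]: "\<And>n. 1 \<le> n \<Longrightarrow> V n \<in> borel_measurable M"
    and open_T: "open T" and zero_T: "0 \<in> T"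
    and integrable_mgf: "\<And>n l. 1 \<le> n \<Longrightarrow> l \<in> T \<Longrightarrow> integrable M (\<lambda>\<omega>. exp (real n * l * V n \<omega>))"
    and cgf_limit: "\<And>l. l \<in> T \<Longrightarrow>
      (\<lambda>n. ln (expectation (\<lambda>\<omega>. exp (real n * l * V n \<omega>))) / real n) \<longlonglongrightarrow> L l"
    and deriv_L: "\<And>l. l \<in> T \<Longrightarrow> (L has_real_derivative D l) (at l)"
begin

definition mgf :: "nat \<Rightarrow> real \<Rightarrow> real" where
  "mgf n l = expectation (\<lambda>\<omega>. exp (real n * l * V n \<omega>))"

text \<open>The unnormalised exponentially tilted law of \<open>V n\<close>; the tilt \<open>0\<close> gives back the law itself, so
  that bounds on it cover both the original and the tilted laws.\<close>
definition tilted :: "nat \<Rightarrow> real \<Rightarrow> real set \<Rightarrow> real" where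
  "tilted n l B = expectation (\<lambda>\<omega>. exp (real n * l * V n \<omega>) * indicator B (V n \<omega>))"

lemma integrable_tilted:
  assumes "1 \<le> n" "l \<in> T" "B \<in> sets borel"
  shows "integrable M (\<lambda>\<omega>. exp (real n * l * V n \<omega>) * indicator B (V n \<omega>))"
proof (rule Bochner_Integration.integrable_bound[OF integrable_mgf[OF assms(1,2)]])
  show "(\<lambda>\<omega>. exp (real n * l * V n \<omega>) * indicator B (V n \<omega>)) \<in> borel_measurable M"
    using assms V[OF assms(1)] by measurable
qed (auto simp: indicator_def)

lemma tilted_zero:
  assumes "1 \<le> n" "B \<in> sets borel"
  shows "tilted n 0 B = prob {\<omega> \<in> space M. V n \<omega> \<in> B}"
proof -
  have "tilted n 0 B = expectation (indicator {\<omega> \<in> space M. V n \<omega> \<in> B})"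
    unfolding tilted_def by (intro Bochner_Integration.integral_cong) (auto simp: indicator_def)
  also have "\<dots> = prob {\<omega> \<in> space M. V n \<omega> \<in> B}"
    by (simp add: Int_def conj_commute)
  finally show ?thesis .
qed

lemma mgf_pos:
  assumes "1 \<le> n" "l \<in> T"
  shows "0 < mgf n l"
proof -
  have "mgf n l \<noteq> 0"
  proof
    assume "mgf n l = 0"
    then have "AE \<omega> in M. exp (real n * l * V n \<omega>) = 0"
      unfolding mgf_def using integrable_mgf[OF assms]
      by (subst (asm) integral_nonneg_eq_0_iff_AE) auto
    then show False by simp
  qed
  moreover have "0 \<le> mgf n l"
    unfolding mgf_def by (rule Bochner_Integration.integral_nonneg) simp
  ultimately show ?thesis by simp
qed

lemma eventually_mgf_between:
  assumes "l \<in> T" "0 < e"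
  shows "eventually (\<lambda>n. 1 \<le> n \<and> exp (real n * (L l - e)) \<le> mgf n l \<and> mgf n l \<le> exp (real n * (L l + e))) sequentially"
proof -
  have "eventually (\<lambda>n. ln (mgf n l) / real n > L l - e) sequentially"
       "eventually (\<lambda>n. ln (mgf n l) / real n < L l + e) sequentially"
    using order_tendstoD[OF cgf_limit[OF assms(1)]] assms(2) by (auto simp: mgf_def)
  then show ?thesis
    using eventually_ge_at_top[of 1]
  proof eventually_elim
    case (elim n)
    then have "real n * (L l - e) < ln (mgf n l)" "ln (mgf n l) < real n * (L l + e)"
      by (auto simp: field_simps)
    then have "exp (real n * (L l - e)) < exp (ln (mgf n l))" "exp (ln (mgf n l)) < exp (real n * (L l + e))"
      by (simp_all only: exp_less_cancel_iff)
    then show ?case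
      using mgf_pos[OF elim(3) assms(1)] elim(3) by simp
  qed
qed

lemma tilted_Chernoff:
  assumes "1 \<le> n" "l \<in> T" "k \<in> T" "B \<in> sets borel"
    and B: "\<And>v. v \<in> B \<Longrightarrow> (k - l) * y \<le> (k - l) * v"
  shows "tilted n l B \<le> exp (- (real n * ((k - l) * y))) * mgf n k"
proof -
  have "exp (real n * l * v) * indicator B v \<le> exp (- (real n * ((k - l) * y))) * exp (real n * k * v)" for v
  proof (cases "v \<in> B")
    case True
    have "real n * ((k - l) * y) \<le> real n * ((k - l) * v)"
      using B[OF True] by (rule mult_left_mono) simp
    then have "real n * l * v \<le> - (real n * ((k - l) * y)) + real n * k * v"
      by (simp add: algebra_simps)
    then show ?thesis
      using True by (simp flip: exp_add)
  qed simp
  then have "tilted n l B \<le> expectation (\<lambda>\<omega>. exp (- (real n * ((k - l) * y))) * exp (real n * k * V n \<omega>))"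
    unfolding tilted_def using assms(1-4) integrable_tilted integrable_mgf
    by (intro integral_mono) auto
  then show ?thesis
    by (simp add: mgf_def)
qed

text \<open>Markov's inequality with the change of tilt from \<open>l\<close> to \<open>k\<close>.  On a half-line starting at
  \<open>y\<close> it gains an exponential factor as soon as \<open>L k\<close> lies below the line of slope \<open>y\<close> through
  \<open>(l, L l)\<close>.  For \<open>l = 0\<close> this is the Chernoff bound, and for other \<open>l\<close> it shows
  that the tilted law concentrates.\<close>
lemma tilted_tail_negligible:
  assumes "l \<in> T" "k \<in> T" "B \<in> sets borel" "0 < a"
    and B: "\<And>v. v \<in> B \<Longrightarrow> (k - l) * y \<le> (k - l) * v"
    and gap: "c + L k < L l + (k - l) * y"
  shows "eventually (\<lambda>n. tilted n l B \<le> a * exp (- (real n * c)) * mgf n l) sequentially"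
proof -
  define e where "e = (L l + (k - l) * y - L k - c) / 3"
  have e: "0 < e" using gap by (simp add: e_def)
  show ?thesis
    using eventually_mgf_between[OF assms(1) e] eventually_mgf_between[OF assms(2) e]
      eventually_exp_decay[OF e assms(4)]
  proof eventually_elim
    case (elim n)
    have "tilted n l B \<le> exp (- (real n * ((k - l) * y))) * mgf n k"
      using elim assms by (intro tilted_Chernoff) auto
    also have "\<dots> \<le> exp (- (real n * ((k - l) * y))) * exp (real n * (L k + e))"
      using elim by (intro mult_left_mono) auto
    also have "\<dots> = exp (- (real n * e)) * exp (- (real n * c)) * exp (real n * (L l - e))"
      unfolding exp_add[symmetric] by (simp add: e_def field_simps)
    also have "\<dots> \<le> a * exp (- (real n * c)) * mgf n l"
      using elim \<open>0 < a\<close> by (intro mult_mono) auto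
    finally show ?case .
  qed
qed

lemma slope_near_tangent:
  assumes "l \<in> T" "0 < \<delta>"
  shows "\<exists>k\<in>T. l < k \<and> L k < L l + (k - l) * (D l + \<delta>)"
    and "\<exists>k\<in>T. k < l \<and> L k < L l + (k - l) * (D l - \<delta>)"
proof -
  have "((\<lambda>k. (L k - L l) / (k - l)) \<longlongrightarrow> D l) (at l)"
    using deriv_L[OF assms(1)] unfolding has_field_derivative_iff .
  then have "eventually (\<lambda>k. dist ((L k - L l) / (k - l)) (D l) < \<delta>) (at l)"
    using assms(2) by (rule tendstoD)
  moreover have "eventually (\<lambda>k. k \<in> T) (at l)"
    using open_T assms(1) by (rule eventually_at_in_open')
  ultimately have "eventually (\<lambda>k. k \<in> T \<and> \<bar>(L k - L l) / (k - l) - D l\<bar> < \<delta>) (at l)"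
    by eventually_elim (simp add: dist_real_def)
  then obtain d where d: "0 < d"
      "\<And>k. k \<noteq> l \<Longrightarrow> dist k l < d \<Longrightarrow> k \<in> T \<and> \<bar>(L k - L l) / (k - l) - D l\<bar> < \<delta>"
    unfolding eventually_at by auto
  have "l + d / 2 \<in> T" "(L (l + d / 2) - L l) / (d / 2) < D l + \<delta>"
    using d(1) d(2)[of "l + d / 2"] by (auto simp: dist_real_def)
  moreover from this(2) have "L (l + d / 2) < L l + (d / 2) * (D l + \<delta>)"
    using d(1) by (simp add: field_simps)
  ultimately show "\<exists>k\<in>T. l < k \<and> L k < L l + (k - l) * (D l + \<delta>)"
    using d(1) by (intro bexI[of _ "l + d / 2"]) auto
  have "l - d / 2 \<in> T" "D l - \<delta> < (L (l - d / 2) - L l) / (- d / 2)"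
    using d(1) d(2)[of "l - d / 2"] by (auto simp: dist_real_def abs_diff_less_iff)
  moreover from this(2) have "L (l - d / 2) < L l + (- d / 2) * (D l - \<delta>)"
    using d(1) by (simp add: field_simps)
  ultimately show "\<exists>k\<in>T. k < l \<and> L k < L l + (k - l) * (D l - \<delta>)"
    using d(1) by (intro bexI[of _ "l - d / 2"]) auto
qed

text \<open>Under the tilt \<open>l\<close> the law of large numbers holds with limit \<open>D l\<close>: a slope strictly between \<open>D l\<close>
  and \<open>D l \<plusminus> \<delta>\<close> makes each of the two tails negligible.\<close>
lemma tilted_concentration:
  assumes l: "l \<in> T" and "0 < \<delta>"
  shows "eventually (\<lambda>n. mgf n l / 2 \<le> tilted n l {D l - \<delta> <..< D l + \<delta>}) sequentially"
proof -
  obtain k where k: "k \<in> T" "l < k" "L k < L l + (k - l) * (D l + \<delta>)"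
    using slope_near_tangent(1)[OF assms] by auto
  obtain j where j: "j \<in> T" "j < l" "L j < L l + (j - l) * (D l - \<delta>)"
    using slope_near_tangent(2)[OF assms] by auto
  have "eventually (\<lambda>n. tilted n l {D l + \<delta> ..} \<le> 1 / 4 * exp (- (real n * 0)) * mgf n l) sequentially"
    using k by (intro tilted_tail_negligible[OF l k(1), where y = "D l + \<delta>"]) auto
  moreover have "eventually (\<lambda>n. tilted n l {.. D l - \<delta>} \<le> 1 / 4 * exp (- (real n * 0)) * mgf n l) sequentially"
    using j by (intro tilted_tail_negligible[OF l j(1), where y = "D l - \<delta>"]) (auto intro: mult_left_mono_neg)
  ultimately show ?thesis
    using eventually_ge_at_top[of 1]
  proof eventually_elim
    case (elim n)
    have "mgf n l = expectation (\<lambda>\<omega>. exp (real n * l * V n \<omega>) * indicator {.. D l - \<delta>} (V n \<omega>) +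
       exp (real n * l * V n \<omega>) * indicator {D l - \<delta> <..< D l + \<delta>} (V n \<omega>) +
       exp (real n * l * V n \<omega>) * indicator {D l + \<delta> ..} (V n \<omega>))"
      unfolding mgf_def using \<open>0 < \<delta>\<close>
      by (intro Bochner_Integration.integral_cong refl) (auto simp: indicator_def)
    also have "\<dots> = tilted n l {.. D l - \<delta>} + tilted n l {D l - \<delta> <..< D l + \<delta>} + tilted n l {D l + \<delta> ..}"
      unfolding tilted_def using elim(3) l integrable_tilted by simp
    finally show ?case
      using elim by simp
  qed
qed

lemma tilted_le_prob:
  assumes "1 \<le> n" "l \<in> T" "0 < \<delta>"
  shows "tilted n l {x - \<delta> <..< x + \<delta>} \<le>
    exp (real n * (l * x + \<bar>l\<bar> * \<delta>)) * prob {\<omega> \<in> space M. V n \<omega> \<in> {x - \<delta> <..< x + \<delta>}}"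
proof -
  have "exp (real n * l * v) * indicator {x - \<delta> <..< x + \<delta>} v \<le>
      exp (real n * (l * x + \<bar>l\<bar> * \<delta>)) * (exp (real n * 0 * v) * indicator {x - \<delta> <..< x + \<delta>} v)" for v
  proof (cases "v \<in> {x - \<delta> <..< x + \<delta>}")
    case True
    have "l * (v - x) \<le> \<bar>l\<bar> * \<bar>v - x\<bar>"
      by (simp flip: abs_mult)
    also have "\<dots> \<le> \<bar>l\<bar> * \<delta>"
      using True by (intro mult_left_mono) auto
    finally have "real n * (l * v) \<le> real n * (l * x + \<bar>l\<bar> * \<delta>)"
      by (intro mult_left_mono) (auto simp: algebra_simps)
    then show ?thesis
      using True by (simp add: mult.assoc)
  qed simp
  then have "tilted n l {x - \<delta> <..< x + \<delta>} \<le> expectation (\<lambda>\<omega>. exp (real n * (l * x + \<bar>l\<bar> * \<delta>)) *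
     (exp (real n * 0 * V n \<omega>) * indicator {x - \<delta> <..< x + \<delta>} (V n \<omega>)))"
    unfolding tilted_def
    by (intro integral_mono integrable_mult_right integrable_tilted zero_T assms) auto
  also have "\<dots> = exp (real n * (l * x + \<bar>l\<bar> * \<delta>)) * tilted n 0 {x - \<delta> <..< x + \<delta>}"
    by (simp add: tilted_def)
  finally show ?thesis
    using tilted_zero[OF assms(1)] by simp
qed

lemma prob_le_mgf:
  assumes "1 \<le> n" "l \<in> T" "0 < \<delta>"
  shows "exp (real n * (l * x - \<bar>l\<bar> * \<delta>)) * prob {\<omega> \<in> space M. V n \<omega> \<in> {x - \<delta> <..< x + \<delta>}} \<le> mgf n l"
proof -
  have "exp (real n * (l * x - \<bar>l\<bar> * \<delta>)) * (exp (real n * 0 * v) * indicator {x - \<delta> <..< x + \<delta>} v) \<le>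
      exp (real n * l * v)" for v
  proof (cases "v \<in> {x - \<delta> <..< x + \<delta>}")
    case True
    have "- (l * (v - x)) \<le> \<bar>l\<bar> * \<bar>v - x\<bar>"
      by (metis abs_ge_minus_self abs_mult)
    also have "\<dots> \<le> \<bar>l\<bar> * \<delta>"
      using True by (intro mult_left_mono) auto
    finally have "real n * (l * x - \<bar>l\<bar> * \<delta>) \<le> real n * (l * v)"
      by (intro mult_left_mono) (auto simp: algebra_simps)
    then show ?thesis
      using True by (simp add: mult.assoc)
  qed simp
  then have "expectation (\<lambda>\<omega>. exp (real n * (l * x - \<bar>l\<bar> * \<delta>)) *
     (exp (real n * 0 * V n \<omega>) * indicator {x - \<delta> <..< x + \<delta>} (V n \<omega>))) \<le> mgf n l"
    unfolding mgf_def
    by (intro integral_mono integrable_mult_right integrable_tilted integrable_mgf zero_T assms) auto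
  then have "exp (real n * (l * x - \<bar>l\<bar> * \<delta>)) * tilted n 0 {x - \<delta> <..< x + \<delta>} \<le> mgf n l"
    by (simp add: tilted_def)
  then show ?thesis
    using tilted_zero[OF assms(1)] by simp
qed

text \<open>Near \<open>D l\<close> the tilting density is almost constant, of size \<open>exp (n l D l)\<close> relative to the
  normalisation \<open>exp (n L l)\<close>; undoing the tilt on the interval that carries its mass costs just this
  factor.\<close>
lemma local_lower_bound:
  assumes l: "l \<in> T" and "0 < \<delta>" "0 < e"
  shows "eventually (\<lambda>n. exp (- (real n * (l * D l - L l + \<bar>l\<bar> * \<delta> + e))) \<le>
    prob {\<omega> \<in> space M. V n \<omega> \<in> {D l - \<delta> <..< D l + \<delta>}}) sequentially"
proof -
  have e: "0 < e / 2" using assms by simp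
  show ?thesis
    using tilted_concentration[OF assms(1,2)] eventually_mgf_between[OF l e] eventually_exp_decay[OF e, of "1 / 2", simplified]
  proof eventually_elim
    case (elim n)
    define p where "p = prob {\<omega> \<in> space M. V n \<omega> \<in> {D l - \<delta> <..< D l + \<delta>}}"
    have "exp (- (real n * e / 2)) * exp (real n * (L l - e / 2)) \<le> 1 / 2 * mgf n l"
      using elim by (intro mult_mono) auto
    also have "\<dots> \<le> exp (real n * (l * D l + \<bar>l\<bar> * \<delta>)) * p"
      using elim tilted_le_prob[of n l \<delta> "D l"] assms by (simp add: p_def)
    finally have "exp (- (real n * (l * D l + \<bar>l\<bar> * \<delta>))) * (exp (- (real n * e / 2)) * exp (real n * (L l - e / 2))) \<le>
        exp (- (real n * (l * D l + \<bar>l\<bar> * \<delta>))) * (exp (real n * (l * D l + \<bar>l\<bar> * \<delta>)) * p)"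
      by (intro mult_left_mono) auto
    also have "\<dots> = p"
      unfolding mult.assoc[symmetric] exp_add[symmetric] by simp
    finally show ?case
      unfolding exp_add[symmetric] p_def[symmetric] by (simp add: algebra_simps)
  qed
qed

text \<open>The moment generating function at \<open>k\<close> is at least the contribution of the values of \<open>V n\<close> near
  \<open>D l\<close>, and \<open>local_lower_bound\<close> estimates the probability of these.\<close>
lemma tangent_below:
  assumes l: "l \<in> T" and k: "k \<in> T"
  shows "L l + (k - l) * D l \<le> L k"
proof (rule field_le_epsilon)
  fix e :: real assume "0 < e"
  define \<delta> where "\<delta> = e / (3 * (\<bar>l\<bar> + \<bar>k\<bar> + 1))"
  have \<delta>: "0 < \<delta>" using \<open>0 < e\<close> by (simp add: \<delta>_def add_nonneg_pos)
  have "(\<bar>l\<bar> + \<bar>k\<bar> + 1) * \<delta> = e / 3"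
    unfolding \<delta>_def by (simp add: divide_simps)
  then have small: "\<bar>l\<bar> * \<delta> + \<bar>k\<bar> * \<delta> \<le> e / 3"
    using \<delta> by (simp add: algebra_simps)
  have e: "0 < e / 3" using \<open>0 < e\<close> by simp
  have "eventually (\<lambda>n. L l + (k - l) * D l \<le> L k + e) sequentially"
    using local_lower_bound[OF l \<delta> e] eventually_mgf_between[OF k e]
  proof eventually_elim
    case (elim n)
    have "exp (real n * (k * D l - \<bar>k\<bar> * \<delta>)) * exp (- (real n * (l * D l - L l + \<bar>l\<bar> * \<delta> + e / 3))) \<le>
        exp (real n * (k * D l - \<bar>k\<bar> * \<delta>)) * prob {\<omega> \<in> space M. V n \<omega> \<in> {D l - \<delta> <..< D l + \<delta>}}"
      using elim by (intro mult_left_mono) auto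
    also have "\<dots> \<le> mgf n k"
      using elim k \<delta> by (intro prob_le_mgf) auto
    also have "\<dots> \<le> exp (real n * (L k + e / 3))"
      using elim by simp
    finally have "real n * (k * D l - \<bar>k\<bar> * \<delta> - (l * D l - L l + \<bar>l\<bar> * \<delta> + e / 3)) \<le> real n * (L k + e / 3)"
      unfolding exp_add[symmetric] by (simp add: algebra_simps)
    then have "k * D l - \<bar>k\<bar> * \<delta> - (l * D l - L l + \<bar>l\<bar> * \<delta> + e / 3) \<le> L k + e / 3"
      using elim by simp
    then show ?case
      using small by (simp add: algebra_simps)
  qed
  then show "L l + (k - l) * D l \<le> L k + e"
    using eventually_happens by fastforce
qed

lemma L_zero: "L 0 = 0"
proof -
  have "(\<lambda>n. ln (expectation (\<lambda>\<omega>. exp (real n * 0 * V n \<omega>))) / real n) \<longlonglongrightarrow> 0"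
    by (simp add: prob_space)
  then show ?thesis
    using cgf_limit[OF zero_T] LIMSEQ_unique by blast
qed

abbreviation J :: "real \<Rightarrow> ereal" where
  "J \<equiv> Legendre T L"

lemma J_ge: "l \<in> T \<Longrightarrow> ereal (l * x - L l) \<le> J x"
  unfolding Legendre_def by (rule SUP_upper)

lemma J_nonneg: "0 \<le> J x"
  using J_ge[OF zero_T, of x] by (simp add: L_zero zero_ereal_def)

lemma J_tangent:
  assumes "l \<in> T"
  shows "J (D l) = ereal (l * D l - L l)"
proof (rule antisym)
  show "J (D l) \<le> ereal (l * D l - L l)"
    unfolding Legendre_def
  proof (rule SUP_least)
    fix k assume "k \<in> T"
    then show "ereal (k * D l - L k) \<le> ereal (l * D l - L l)"
      using tangent_below[OF assms, of k] by (simp add: algebra_simps)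
  qed
qed (rule J_ge[OF assms])

text \<open>A tilt that certifies a positive rate at \<open>x\<close> points from the mean \<open>D 0\<close> towards \<open>x\<close>, by the tangent
  at \<open>0\<close>.  Hence its Chernoff bound applies to the half-line beyond \<open>x\<close>.\<close>
lemma positive_tilt_side:
  assumes "l \<in> T" "0 < l * x - L l"
  shows "0 < l * (x - D 0)"
  using tangent_below[OF zero_T assms(1)] assms(2) L_zero by (simp add: algebra_simps)

lemma rate_function_J: "rate_function J"
  unfolding rate_function_def using J_nonneg lower_semicontinuous_Legendre by blast

lemma good_rate_function_J: "good_rate_function J"
  unfolding good_rate_function_def
proof (intro conjI allI rate_function_J)
  fix b :: real
  obtain r where r: "0 < r" "cball 0 r \<subseteq> T"
    using open_T zero_T open_contains_cball by metis
  then have rT: "r \<in> T" "- r \<in> T"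
    by auto
  have "{x. 0 \<le> J x \<and> J x \<le> ereal b} = (\<Inter>l\<in>T. {x. l * x - L l \<le> b})"
    using J_nonneg by (auto simp: Legendre_def SUP_le_iff)
  moreover have "closed (\<Inter>l\<in>T. {x. l * x - L l \<le> b})"
    by (intro closed_INT ballI closed_Collect_le continuous_intros)
  moreover have "(\<Inter>l\<in>T. {x. l * x - L l \<le> b}) \<subseteq> {- ((b + L (- r)) / r) .. (b + L r) / r}"
  proof
    fix x assume "x \<in> (\<Inter>l\<in>T. {x. l * x - L l \<le> b})"
    then have "r * x - L r \<le> b" "- r * x - L (- r) \<le> b"
      using rT by blast+
    then show "x \<in> {- ((b + L (- r)) / r) .. (b + L r) / r}"
      using r(1) by (simp add: field_simps)
  qed
  ultimately show "compact {x. 0 \<le> J x \<and> J x \<le> ereal b}"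
    using bounded_subset[OF bounded_closed_interval] by (auto simp: compact_eq_bounded_closed)
qed

lemma half_line_upper_bound:
  assumes l: "l \<in> T" and c: "c < l * y - L l" and B: "B \<in> sets borel" "\<And>v. v \<in> B \<Longrightarrow> l * y \<le> l * v"
  shows "eventually (\<lambda>n. prob {\<omega> \<in> space M. V n \<omega> \<in> B} \<le> exp (- (real n * c)) / 2) sequentially"
proof -
  have "eventually (\<lambda>n. tilted n 0 B \<le> 1 / 2 * exp (- (real n * c)) * mgf n 0) sequentially"
    using assms L_zero by (intro tilted_tail_negligible[OF zero_T l, where y = y]) auto
  then show ?thesis
    using eventually_ge_at_top[of 1]
    by eventually_elim (simp add: tilted_zero B(1) mgf_def prob_space)
qed

text \<open>If the rate exceeds some \<open>c \<ge> 0\<close> on \<open>F\<close>, then \<open>F\<close> avoids \<open>D 0\<close>.  It is therefore covered by the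
  two half-lines beyond its points nearest to \<open>D 0\<close> on either side.\<close>
lemma closed_upper_bound:
  assumes F: "closed F" and c: "ereal c < (INF x\<in>F. J x)"
  shows "limsup (\<lambda>n. ereal (1 / real n) * elog (prob {\<omega> \<in> space M. V n \<omega> \<in> F})) \<le> ereal (- c)"
proof (cases "c < 0")
  case True
  have "eventually (\<lambda>n. prob {\<omega> \<in> space M. V n \<omega> \<in> F} \<le> exp (- (real n * c))) sequentially"
    using True by (intro always_eventually allI order_trans[OF prob_le_1]) (simp add: mult_nonneg_nonpos)
  then have "eventually (\<lambda>n. ereal (1 / real n) * elog (prob {\<omega> \<in> space M. V n \<omega> \<in> F}) \<le> ereal (- c)) sequentially"
    using eventually_ge_at_top[of 1] by eventually_elim (rule elog_upper)
  then show ?thesis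
    by (rule Limsup_bounded)
next
  case False
  have tilt: "\<exists>l\<in>T. c < l * x - L l \<and> 0 < l * (x - D 0)" if "x \<in> F" for x
  proof -
    have "ereal c < J x"
      using c that by (meson INF_lower less_le_trans)
    then obtain l where "l \<in> T" "c < l * x - L l"
      by (auto simp: Legendre_def less_SUP_iff)
    then show ?thesis
      using False positive_tilt_side[of l x] by auto
  qed
  have m: "D 0 \<notin> F"
    using tilt[of "D 0"] by auto
  note [measurable] = borel_closed[OF F]
  have right: "eventually (\<lambda>n. prob {\<omega> \<in> space M. V n \<omega> \<in> F \<inter> {D 0 ..}} \<le> exp (- (real n * c)) / 2) sequentially"
  proof (cases "F \<inter> {D 0 ..} = {}")
    case False
    define b where "b = Inf (F \<inter> {D 0 ..})"
    have bdd: "bdd_below (F \<inter> {D 0 ..})" by auto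
    then have b: "b \<in> F \<inter> {D 0 ..}"
      unfolding b_def using False F by (intro closed_contains_Inf) auto
    obtain l where l: "l \<in> T" "c < l * b - L l" "0 < l * (b - D 0)"
      using tilt b by blast
    have "0 < l"
      using l(3) b by (auto simp: zero_less_mult_iff)
    then show ?thesis
      using cInf_lower[OF _ bdd] by (intro half_line_upper_bound[OF l(1,2)]) (auto simp: b_def)
  qed simp
  have left: "eventually (\<lambda>n. prob {\<omega> \<in> space M. V n \<omega> \<in> F \<inter> {.. D 0}} \<le> exp (- (real n * c)) / 2) sequentially"
  proof (cases "F \<inter> {.. D 0} = {}")
    case False
    define a where "a = Sup (F \<inter> {.. D 0})"
    have bdd: "bdd_above (F \<inter> {.. D 0})" by auto
    then have a: "a \<in> F \<inter> {.. D 0}"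
      unfolding a_def using False F by (intro closed_contains_Sup) auto
    obtain l where l: "l \<in> T" "c < l * a - L l" "0 < l * (a - D 0)"
      using tilt a by blast
    have "l < 0"
      using l(3) a by (auto simp: zero_less_mult_iff)
    then show ?thesis
      using cSup_upper[OF _ bdd] by (intro half_line_upper_bound[OF l(1,2)]) (auto simp: a_def)
  qed simp
  have "eventually (\<lambda>n. prob {\<omega> \<in> space M. V n \<omega> \<in> F} \<le> exp (- (real n * c))) sequentially"
    using left right eventually_ge_at_top[of 1]
  proof eventually_elim
    case (elim n)
    note [measurable] = V[OF elim(3)]
    have "prob {\<omega> \<in> space M. V n \<omega> \<in> F} =
      prob ({\<omega> \<in> space M. V n \<omega> \<in> F \<inter> {.. D 0}} \<union> {\<omega> \<in> space M. V n \<omega> \<in> F \<inter> {D 0 ..}})"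
      by (rule arg_cong[of _ _ prob]) auto
    also have "\<dots> \<le> prob {\<omega> \<in> space M. V n \<omega> \<in> F \<inter> {.. D 0}} + prob {\<omega> \<in> space M. V n \<omega> \<in> F \<inter> {D 0 ..}}"
      by (rule measure_Un_le) measurable
    finally show ?case
      using elim by simp
  qed
  then have "eventually (\<lambda>n. ereal (1 / real n) * elog (prob {\<omega> \<in> space M. V n \<omega> \<in> F}) \<le> ereal (- c)) sequentially"
    using eventually_ge_at_top[of 1] by eventually_elim (rule elog_upper)
  then show ?thesis
    by (rule Limsup_bounded)
qed

lemma open_lower_bound:
  assumes G: "open G" and l: "l \<in> T" "D l \<in> G"
  shows "- J (D l) \<le> liminf (\<lambda>n. ereal (1 / real n) * elog (prob {\<omega> \<in> space M. V n \<omega> \<in> G}))"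
    (is "_ \<le> liminf ?p")
proof -
  have "ereal (- (l * D l - L l)) \<le> liminf ?p"
  proof (rule ereal_le_epsilon2)
    fix e :: real assume e: "0 < e"
    then have e2: "0 < e / 2" by simp
    obtain r where r: "0 < r" "ball (D l) r \<subseteq> G"
      using G l(2) open_contains_ball by metis
    define \<delta> where "\<delta> = min r (e / (2 * (\<bar>l\<bar> + 1)))"
    have \<delta>: "0 < \<delta>" "\<delta> \<le> e / (2 * (\<bar>l\<bar> + 1))"
      using r(1) e by (auto simp: \<delta>_def add_nonneg_pos)
    have small: "\<bar>l\<bar> * \<delta> \<le> e / 2"
    proof -
      have "\<bar>l\<bar> * \<delta> \<le> (\<bar>l\<bar> + 1) * (e / (2 * (\<bar>l\<bar> + 1)))"
        using \<delta> by (intro mult_mono) auto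
      also have "\<dots> = e / 2"
        by (simp add: divide_simps)
      finally show ?thesis .
    qed
    have sub: "{D l - \<delta> <..< D l + \<delta>} \<subseteq> G"
      using r(2) by (auto simp: \<delta>_def dist_real_def subset_eq)
    have "eventually (\<lambda>n. ereal (- (l * D l - L l + e)) \<le> ?p n) sequentially"
      using local_lower_bound[OF l(1) \<delta>(1) e2] eventually_ge_at_top[of 1]
    proof eventually_elim
      case (elim n)
      note [measurable] = V[OF elim(2)] borel_open[OF G]
      have "exp (- (real n * (l * D l - L l + e))) \<le> exp (- (real n * (l * D l - L l + \<bar>l\<bar> * \<delta> + e / 2)))"
        using small by (simp add: mult_left_mono)
      also have "\<dots> \<le> prob {\<omega> \<in> space M. V n \<omega> \<in> {D l - \<delta> <..< D l + \<delta>}}"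
        using elim e by simp
      also have "\<dots> \<le> prob {\<omega> \<in> space M. V n \<omega> \<in> G}"
        using sub by (intro finite_measure_mono) auto
      finally show ?case
        using elim(2) by (intro elog_lower)
    qed
    then have "ereal (- (l * D l - L l + e)) \<le> liminf ?p"
      by (rule Liminf_bounded)
    then have "ereal (- (l * D l - L l + e)) + ereal e \<le> liminf ?p + ereal e"
      by (rule add_right_mono)
    then show "ereal (- (l * D l - L l)) \<le> liminf ?p + ereal e"
      by simp
  qed
  then show ?thesis
    by (simp add: J_tangent[OF l(1)])
qed

text \<open>The steepness assumption says that every point of finite rate is the slope of \<open>L\<close> at some tilt.
  The lower bound can be localised only at such points.\<close>
theorem Gaertner_Ellis:
  assumes steep: "\<And>x. J x \<noteq> \<infinity> \<Longrightarrow> x \<in> D ` T"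
  shows "satisfies_LDP M V J"
  unfolding satisfies_LDP_def
proof (intro conjI allI impI rate_function_J)
  show "V n \<in> borel_measurable M" if "1 \<le> n" for n
    using that by measurable
next
  fix F :: "real set" assume F: "closed F"
  let ?l = "limsup (\<lambda>n. ereal (1 / real n) * elog (prob {\<omega> \<in> space M. V n \<omega> \<in> F}))"
  show "?l \<le> - (INF x\<in>F. J x)"
  proof (rule ccontr)
    assume "\<not> ?l \<le> - (INF x\<in>F. J x)"
    then have "- ?l < (INF x\<in>F. J x)"
      by (simp add: not_le ereal_uminus_less_reorder)
    then obtain c where c: "- ?l < ereal c" "ereal c < (INF x\<in>F. J x)"
      using ereal_dense2 by blast
    have "- ereal (- c) \<le> - ?l"
      unfolding ereal_minus_le_minus by (rule closed_upper_bound[OF F c(2)])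
    then show False
      using c(1) by simp
  qed
next
  fix G :: "real set" assume G: "open G"
  let ?l = "liminf (\<lambda>n. ereal (1 / real n) * elog (prob {\<omega> \<in> space M. V n \<omega> \<in> G}))"
  have "- ?l \<le> J x" if "x \<in> G" for x
  proof (cases "J x = \<infinity>")
    case False
    then obtain l where "l \<in> T" "x = D l"
      using steep by auto
    then show ?thesis
      using open_lower_bound[OF G, of l] that by (simp add: ereal_uminus_le_reorder)
  qed simp
  then have "- ?l \<le> (INF x\<in>G. J x)"
    by (rule INF_greatest)
  then show "- (INF x\<in>G. J x) \<le> ?l"
    by (simp add: ereal_uminus_le_reorder)
qed

end

section \<open>A rational parametrisation of the tilts\<close>

text \<open>The solution \<open>l\<close> of \<open>1 - 2 l (1 + \<phi>\<^sup>2 + 2 \<phi> cos \<theta>) = \<kappa> \<bar>1 - s \<phi> e\<^sup>i\<^sup>\<theta>\<bar>\<^sup>2\<close> for a given \<open>s\<close>, in which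
  \<open>\<kappa> = 1 / ((1 + s) (1 + s \<phi>\<^sup>2))\<close>: for \<open>\<phi> \<noteq> 0\<close>, comparing the coefficients of \<open>cos \<theta>\<close> gives \<open>2 l = \<kappa> s\<close>, and the
  constant ones then determine \<open>\<kappa>\<close>.\<close>
definition tilt :: "real \<Rightarrow> real \<Rightarrow> real" where
  "tilt \<phi> s = s / (2 * (1 + s) * (1 + s * \<phi>\<^sup>2))"

text \<open>The slope of the limiting cumulant generating function at \<open>tilt \<phi> s\<close>, hence the value around which
  the tilted quadratic means concentrate; see \<open>cgf_has_derivative\<close>.\<close>
definition mean :: "real \<Rightarrow> real \<Rightarrow> real" where
  "mean \<phi> s = (1 + \<phi>\<^sup>2 + 2 * s * \<phi>\<^sup>2) * (1 + s) * (1 + s * \<phi>\<^sup>2) / (1 - s\<^sup>2 * \<phi>\<^sup>2)"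

text \<open>The bounds on \<open>s\<close> express that \<open>\<kappa>\<close> is positive and that the zero of \<open>1 - s \<phi> z\<close> lies
  outside the closed unit disc.\<close>
definition admissible :: "real \<Rightarrow> real \<Rightarrow> bool" where
  "admissible \<phi> s \<longleftrightarrow> -1 < \<phi> \<and> \<phi> < 1 \<and> -1 < s \<and> s\<^sup>2 * \<phi>\<^sup>2 < 1"

lemma admissible_pos:
  assumes "admissible \<phi> s"
  shows "0 < 1 + s" "0 < 1 + s * \<phi>\<^sup>2" "0 < 1 - s\<^sup>2 * \<phi>\<^sup>2" "0 < 1 + \<phi>\<^sup>2 + 2 * s * \<phi>\<^sup>2" "\<phi>\<^sup>2 < 1" "0 < 1 - \<phi>\<^sup>2"
    "0 < (1 + s) * (1 + s * \<phi>\<^sup>2)"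
proof -
  show s: "0 < 1 + s" and "0 < 1 - s\<^sup>2 * \<phi>\<^sup>2"
    using assms by (auto simp: admissible_def)
  show p: "\<phi>\<^sup>2 < 1"
    using assms by (auto simp: admissible_def abs_square_less_1)
  then show "0 < 1 - \<phi>\<^sup>2" by simp
  have "- (1 * \<phi>\<^sup>2) \<le> s * \<phi>\<^sup>2"
    using s mult_right_mono[of "-1" s "\<phi>\<^sup>2"] by simp
  then show t: "0 < 1 + s * \<phi>\<^sup>2" and "0 < 1 + \<phi>\<^sup>2 + 2 * s * \<phi>\<^sup>2"
    using p by linarith+
  show "0 < (1 + s) * (1 + s * \<phi>\<^sup>2)"
    using s t by simp
qed

lemma mean_pos: "admissible \<phi> s \<Longrightarrow> 0 < mean \<phi> s"
  using admissible_pos[of \<phi> s] by (simp add: mean_def)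

section \<open>The cubic equation for the tilt\<close>

text \<open>A depressed cubic is strictly decreasing between its critical points \<open>\<plusminus> sqrt B\<close>, so that it takes every
  value at most once there.  Identifying the explicit root therefore needs only a bound on it, and no
  choice of a branch of the cube root has to be followed as \<open>x\<close> varies.\<close>
lemma depressed_cubic_middle_root_unique:
  fixes u v B c :: real
  assumes "u ^ 3 - 3 * B * u = c" "v ^ 3 - 3 * B * v = c" "u\<^sup>2 \<le> B" "v\<^sup>2 \<le> B"
  shows "u = v"
proof (rule ccontr)
  assume "u \<noteq> v"
  have "(u - v) * (u\<^sup>2 + u * v + v\<^sup>2 - 3 * B) = (u ^ 3 - 3 * B * u) - (v ^ 3 - 3 * B * v)"
    by algebra
  then have "(u - v) * (u\<^sup>2 + u * v + v\<^sup>2 - 3 * B) = 0"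
    using assms(1,2) by simp
  then have "u\<^sup>2 + u * v + v\<^sup>2 = 3 * B"
    using \<open>u \<noteq> v\<close> by simp
  then have "(u - v)\<^sup>2 \<le> 0"
    using assms(3,4) by (simp add: power2_diff)
  then show False
    using \<open>u \<noteq> v\<close> by simp
qed

text \<open>With \<open>z = r\<^sup>3 e\<^sup>i\<^sup>3\<^sup>t\<close> in the upper half plane, the principal cube root has an argument \<open>t\<close> between
  \<open>0\<close> and \<open>\<pi> / 3\<close>.  The factor \<open>- (1 + \<i> \<surd>3)\<close> is \<open>- 2 e\<^sup>i\<^sup>\<pi>\<^sup>/\<^sup>3\<close>, so that
  \<open>2 Re C = - 4 r cos (t + \<pi> / 3)\<close>.  The cubic is the formula for \<open>cos (3 (t + \<pi> / 3))\<close>, and the bound says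
  that the angle \<open>t + \<pi> / 3\<close> is within \<open>\<pi> / 6\<close> of a right angle.\<close>
lemma Cardano_root:
  fixes z :: complex and C :: complex
  assumes "0 < Im z" and C: "C = - (1 + \<i> * of_real (sqrt 3)) * z powr (1 / 3)"
  shows "(2 * Re C) ^ 3 - 3 * (cmod C)\<^sup>2 * (2 * Re C) = 16 * Re z" and "(2 * Re C)\<^sup>2 \<le> (cmod C)\<^sup>2"
proof -
  have z: "z \<noteq> 0" using assms by auto
  define r where "r = cmod (z powr (1/3))"
  define t where "t = Arg z / 3"
  have t: "0 \<le> t" "t \<le> pi / 3"
    using Arg_lt_pi[of z] \<open>0 < Im z\<close> Arg_bounded[of z] by (auto simp: t_def)
  have w: "z powr (1/3) = rcis r t"
    using z by (simp add: r_def t_def powr_def Ln_Arg rcis_def cis_conv_exp norm_exp exp_add[symmetric] exp_of_real algebra_simps flip: of_real_mult exp_of_real)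
  have r3: "rcis (r^3) (3 * t) = z"
  proof -
    have "(z powr (1/3)) ^ 3 = z"
      using z by (simp add: powr_def exp_of_nat_mult[symmetric])
    then show ?thesis unfolding w by (simp add: DeMoivre2)
  qed
  have m: "- (1 + \<i> * of_real (sqrt 3)) = - rcis 2 (pi / 3)"
    by (simp add: complex_eq_iff rcis_def cos_60 sin_60)
  have C': "C = - rcis (2 * r) (t + pi / 3)"
    unfolding C w m by (simp add: rcis_mult add_ac)
  have nC: "(cmod C)\<^sup>2 = 4 * r\<^sup>2"
    unfolding C' by (simp add: power_mult_distrib)
  have ReC: "Re C = - 2 * r * cos (t + pi / 3)"
    unfolding C' by simp
  have "cos (t + pi / 3) \<le> cos (pi / 3)"
    using t by (intro cos_monotone_0_pi_le) auto
  moreover have "cos (2 * pi / 3) \<le> cos (t + pi / 3)"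
    using t by (intro cos_monotone_0_pi_le) auto
  ultimately have "\<bar>cos (t + pi / 3)\<bar> \<le> 1 / 2"
    by (simp add: cos_60 cos_120)
  then have "(cos (t + pi / 3))\<^sup>2 \<le> (1/2)\<^sup>2"
    by (subst abs_le_square_iff[symmetric]) simp
  then have "16 * r\<^sup>2 * (cos (t + pi / 3))\<^sup>2 \<le> 16 * r\<^sup>2 * (1/2)\<^sup>2"
    by (intro mult_left_mono) auto
  then show "(2 * Re C)\<^sup>2 \<le> (cmod C)\<^sup>2"
    unfolding nC ReC by (simp add: power2_eq_square)
  have "Re z = r ^ 3 * cos (3 * t)"
    by (subst r3[symmetric]) (simp add: rcis_def)
  moreover have "cos (3 * (t + pi / 3)) = - cos (3 * t)"
    by (simp add: distrib_left)
  moreover have "cos (3 * (t + pi / 3)) = 4 * cos (t + pi / 3) ^ 3 - 3 * cos (t + pi / 3)"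
    by (rule cos_treble_cos)
  ultimately have "Re z = r ^ 3 * - (4 * cos (t + pi / 3) ^ 3 - 3 * cos (t + pi / 3))"
    by (metis minus_minus)
  then show "(2 * Re C) ^ 3 - 3 * (cmod C)\<^sup>2 * (2 * Re C) = 16 * Re z"
    unfolding nC ReC by (simp add: power2_eq_square power3_eq_cube algebra_simps)
qed

lemma c_fun_neg:
  assumes "x > 0" "\<phi>\<^sup>2 < 1"
  shows "c_fun \<phi> x < 0"
proof -
  have "0 < x^8 * (\<phi>^2 - 1)^4 *
     (4 * x^4 * \<phi>^2 + 32 * x^3 * (\<phi>^4 + \<phi>^2) + x^2 * (\<phi>^4 + 46 * \<phi>^2 + 1) * (\<phi>^2 - 1)^2
      + 6 * x * (\<phi>^2 + 1) * (\<phi>^2 - 1)^4 + (\<phi>^2 - 1)^6)"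
    using assms by (intro mult_pos_pos add_nonneg_pos add_nonneg_nonneg mult_nonneg_nonneg) auto
  then show ?thesis
    unfolding c_fun_def by simp
qed

lemma lambda_fun_root:
  assumes "x > 0" "\<phi>\<^sup>2 < 1"
  shows "\<exists>u. lambda_fun \<phi> x = (A_fun \<phi> x + u) / (12 * x\<^sup>2 * (\<phi>\<^sup>2 - 1)\<^sup>2) \<and>
     u ^ 3 - 3 * B_fun \<phi> x * u = 16 * C_poly \<phi> x \<and> u\<^sup>2 \<le> B_fun \<phi> x"
proof (intro exI conjI)
  define z :: complex where
    "z = of_real (C_poly \<phi> x) + 3 * of_real (sqrt 3) * csqrt (of_real (c_fun \<phi> x))"
  have z: "z = Complex (C_poly \<phi> x) (3 * sqrt 3 * sqrt (- c_fun \<phi> x))"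
    unfolding z_def using c_fun_neg[OF assms] by (simp add: csqrt_of_real_nonpos complex_eq_iff)
  have "0 < Im z"
    unfolding z using c_fun_neg[OF assms] by simp
  note root = Cardano_root[OF this C_fun_def[of \<phi> x, folded z_def]]
  show "(2 * Re (C_fun \<phi> x)) ^ 3 - 3 * B_fun \<phi> x * (2 * Re (C_fun \<phi> x)) = 16 * C_poly \<phi> x"
    using root(1) by (simp add: C_fun_norm[OF assms(1)] z)
  show "(2 * Re (C_fun \<phi> x))\<^sup>2 \<le> B_fun \<phi> x"
    using root(2) by (simp add: C_fun_norm[OF assms(1)])
  have "of_real (B_fun \<phi> x) = C_fun \<phi> x * cnj (C_fun \<phi> x)"
    using C_fun_norm[OF assms(1), of \<phi>] complex_norm_square[of "C_fun \<phi> x"] by (metis of_real_power)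
  then have "of_real (B_fun \<phi> x) / C_fun \<phi> x = cnj (C_fun \<phi> x)"
    by (cases "C_fun \<phi> x = 0") auto
  then show "lambda_fun \<phi> x = (A_fun \<phi> x + 2 * Re (C_fun \<phi> x)) / (12 * x\<^sup>2 * (\<phi>\<^sup>2 - 1)\<^sup>2)"
    unfolding lambda_fun_def lambda_complex_def by (simp only: Re_divide_of_real) simp
qed

text \<open>Solving the definition of \<open>lambda_fun\<close> for the term \<open>2 Re C\<close> gives a candidate \<open>u\<close> for the root.  Over the
  parameter \<open>s\<close> it is rational, and the two conditions of \<open>depressed_cubic_middle_root_unique\<close> become
  a polynomial identity and a polynomial inequality.  The inequality holds because
  \<open>B - u\<^sup>2\<close> is a positive multiple of \<open>H\<close>, and \<open>(1 + q) H\<close> is a square plus \<open>2 p (1 - q)\<^sup>3\<close>.\<close>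
lemma lambda_fun_mean:
  assumes "admissible \<phi> s"
  shows "lambda_fun \<phi> (mean \<phi> s) = tilt \<phi> s"
proof -
  define p q E N w x H U where "p = \<phi>\<^sup>2" and "q = s\<^sup>2 * p" and "E = (1 + s) * (1 + s * p)"
    and "N = 1 + p + 2 * s * p" and "w = (p - 1)\<^sup>2" and "x = mean \<phi> s"
    and "H = (1 + p)\<^sup>2 * (1 + q) + 8 * p * (1 + p) * s + 2 * p + 8 * p * q - 2 * p * q\<^sup>2"
    and "U = 3 * w * N * s / 2 - N * E * (1 + p) + w * (1 - q)"
  have pos: "0 < E" "0 < 1 - q" "p < 1" "0 \<le> p" "0 < x"
    using admissible_pos[OF assms] mean_pos[OF assms] by (auto simp: p_def q_def E_def x_def)
  have x: "x = N * E / (1 - q)" "x * (1 - q) = N * E"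
    using pos by (auto simp: x_def mean_def N_def E_def q_def p_def)
  have l: "tilt \<phi> s = s / (2 * E)"
    by (simp add: tilt_def E_def p_def)
  have w: "0 < w"
    using pos by (simp add: w_def)
  have phi4: "\<phi>^4 = p^2" "\<phi>^6 = p^3"
    by (simp_all add: p_def flip: power_mult)
  define u where "u = 12 * x\<^sup>2 * w * tilt \<phi> s - A_fun \<phi> x"
  have u: "u = 4 * x * U / (1 - q)"
  proof -
    have "x * tilt \<phi> s = N * s / (2 * (1 - q))"
      using pos by (simp add: x(1) l)
    then have "u = 4 * x * (3 * w * (N * s / (2 * (1 - q))) - x * (1 + p) + w)"
      unfolding u_def A_fun_def p_def[symmetric] w_def[symmetric] by algebra
    moreover have "3 * w * (N * s / (2 * (1 - q))) - x * (1 + p) + w = U / (1 - q)"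
      using pos by (simp add: U_def x(1) divide_simps) algebra
    ultimately show ?thesis
      by simp
  qed
  have B: "B_fun \<phi> x = 4 * x\<^sup>2 * ((N * E)\<^sup>2 * (p\<^sup>2 + 14 * p + 1) + 4 * (N * E) * (1 - q) * (p + 1) * w
      + (1 - q)\<^sup>2 * w\<^sup>2) / (1 - q)\<^sup>2"
    unfolding B_fun_def phi4 p_def[symmetric] x(2)[symmetric] w_def
    using pos by (simp add: divide_simps) algebra
  have C: "C_poly \<phi> x = x^3 * (- ((N * E)^3) * (p^3 - 33 * p\<^sup>2 - 33 * p + 1)
      - 6 * (N * E)\<^sup>2 * (1 - q) * w * (p\<^sup>2 - 10 * p + 1)
      + 6 * (N * E) * (1 - q)\<^sup>2 * w\<^sup>2 * (p + 1) + (1 - q)^3 * w^3) / (1 - q)^3"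
    unfolding C_poly_def phi4 p_def[symmetric] x(2)[symmetric] w_def
    using pos by (simp add: divide_simps) algebra
  have gap: "(N * E)\<^sup>2 * (p\<^sup>2 + 14 * p + 1) + 4 * (N * E) * (1 - q) * (p + 1) * w
      + (1 - q)\<^sup>2 * w\<^sup>2 - 4 * U\<^sup>2 = 6 * w * H * E"
    unfolding U_def H_def N_def E_def w_def q_def by algebra
  have "(1 + q) * H = ((1 + p) * (1 + q) + 4 * p * s)\<^sup>2 + 2 * p * (1 - q) ^ 3"
    unfolding H_def q_def by algebra
  moreover have "0 \<le> ((1 + p) * (1 + q) + 4 * p * s)\<^sup>2 + 2 * p * (1 - q) ^ 3" "0 < 1 + q"
    using pos by (auto simp: q_def add_pos_nonneg)
  ultimately have "0 \<le> H"
    by (metis zero_le_mult_iff less_le_not_le)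
  then have "0 \<le> (N * E)\<^sup>2 * (p\<^sup>2 + 14 * p + 1) + 4 * (N * E) * (1 - q) * (p + 1) * w
      + (1 - q)\<^sup>2 * w\<^sup>2 - 4 * U\<^sup>2"
    unfolding gap using w pos by simp
  then have "4 * x\<^sup>2 * (4 * U\<^sup>2) / (1 - q)\<^sup>2 \<le> B_fun \<phi> x"
    unfolding B by (intro divide_right_mono mult_left_mono) auto
  then have uB: "u\<^sup>2 \<le> B_fun \<phi> x"
    by (simp add: u power_mult_distrib power_divide)
  have cubic: "4 * U ^ 3 - 3 * U * ((N * E)\<^sup>2 * (p\<^sup>2 + 14 * p + 1) + 4 * (N * E) * (1 - q) * (p + 1) * w
      + (1 - q)\<^sup>2 * w\<^sup>2) = (- ((N * E)^3) * (p^3 - 33 * p\<^sup>2 - 33 * p + 1)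
      - 6 * (N * E)\<^sup>2 * (1 - q) * w * (p\<^sup>2 - 10 * p + 1)
      + 6 * (N * E) * (1 - q)\<^sup>2 * w\<^sup>2 * (p + 1) + (1 - q)^3 * w^3)"
    unfolding U_def N_def E_def w_def q_def by algebra
  have "u ^ 3 - 3 * B_fun \<phi> x * u = 16 * C_poly \<phi> x"
  proof -
    have "(4 * x * U / (1 - q)) ^ 3 - 3 * (4 * x\<^sup>2 * R / (1 - q)\<^sup>2) * (4 * x * U / (1 - q)) =
        16 * (x ^ 3 * (4 * U ^ 3 - 3 * U * R) / (1 - q) ^ 3)" for R
      using pos by (simp add: divide_simps) algebra
    then show ?thesis
      unfolding C cubic[symmetric] u B .
  qed
  moreover obtain v where v: "lambda_fun \<phi> x = (A_fun \<phi> x + v) / (12 * x\<^sup>2 * (\<phi>\<^sup>2 - 1)\<^sup>2)"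
     "v ^ 3 - 3 * B_fun \<phi> x * v = 16 * C_poly \<phi> x" "v\<^sup>2 \<le> B_fun \<phi> x"
    using lambda_fun_root[of x \<phi>] pos by (auto simp: p_def)
  ultimately have "v = u"
    using uB depressed_cubic_middle_root_unique by blast
  then have "lambda_fun \<phi> x = 12 * x\<^sup>2 * w * tilt \<phi> s / (12 * x\<^sup>2 * w)"
    unfolding v(1) u_def by (simp add: w_def p_def)
  then show ?thesis
    using pos w by (simp add: x_def)
qed

section \<open>The moment generating function of the Gaussian quadratic form\<close>

lemma nn_integral_gaussian:
  fixes a b :: real
  assumes "a < 1 / 2"
  shows "(\<integral>\<^sup>+u. ennreal (exp (a * u\<^sup>2 + b * u)) \<partial>density lborel std_normal_density) =
    ennreal (exp (b\<^sup>2 / (2 * (1 - 2 * a))) / sqrt (1 - 2 * a))"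
proof -
  define v where "v = 1 - 2 * a"
  have v: "0 < v" using assms by (simp add: v_def)
  have "std_normal_density u * exp (a * u\<^sup>2 + b * u) =
      exp (b\<^sup>2 / (2 * v)) / sqrt v * normal_density (b / v) (1 / sqrt v) u" for u
  proof -
    have "- u\<^sup>2 / 2 + (a * u\<^sup>2 + b * u) = b\<^sup>2 / (2 * v) + - (u - b / v)\<^sup>2 * v / 2"
      using v by (simp add: v_def divide_simps) algebra
    then have "exp (- u\<^sup>2 / 2) * exp (a * u\<^sup>2 + b * u) = exp (b\<^sup>2 / (2 * v)) * exp (- (u - b / v)\<^sup>2 * v / 2)"
      by (simp only: exp_add[symmetric])
    then show ?thesis
      using v by (simp add: normal_density_def real_sqrt_mult real_sqrt_divide power_divide field_simps)
  qed
  note eq = this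
  have "(\<integral>\<^sup>+u. ennreal (exp (a * u\<^sup>2 + b * u)) \<partial>density lborel std_normal_density) =
     (\<integral>\<^sup>+u. ennreal (exp (b\<^sup>2 / (2 * v)) / sqrt v) * ennreal (normal_density (b / v) (1 / sqrt v) u) \<partial>lborel)"
    using v by (subst nn_integral_density) (auto simp: eq simp flip: ennreal_mult)
  also have "\<dots> = ennreal (exp (b\<^sup>2 / (2 * v)) / sqrt v) * (\<integral>\<^sup>+u. ennreal (normal_density (b / v) (1 / sqrt v) u) \<partial>lborel)"
    by (rule nn_integral_cmult) auto
  also have "(\<integral>\<^sup>+u. ennreal (normal_density (b / v) (1 / sqrt v) u) \<partial>lborel) = 1"
    using v by (subst nn_integral_eq_integral) auto
  finally show ?thesis
    by (simp add: v_def)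
qed

definition gauss :: "real measure" where
  "gauss = density lborel std_normal_density"

interpretation gauss: prob_space gauss
  unfolding gauss_def by (rule prob_space_normal_density) simp

interpretation gauss_seq: product_sigma_finite "\<lambda>_::nat. gauss"
  by standard

lemma sets_gauss [simp, measurable_cong]: "sets gauss = sets borel"
  by (simp add: gauss_def)

lemma space_gauss [simp]: "space gauss = UNIV"
  by (simp add: gauss_def)

definition energy :: "real \<Rightarrow> nat \<Rightarrow> (nat \<Rightarrow> real) \<Rightarrow> real" where
  "energy \<phi> n x = (\<Sum>k = 1..n. (x k + \<phi> * x (k - 1))\<^sup>2)"

lemma measurable_energy [measurable]: "energy \<phi> n \<in> borel_measurable (PiM {..n} (\<lambda>_. gauss))"
  unfolding energy_def
  by (intro borel_measurable_sum borel_measurable_power borel_measurable_add borel_measurable_times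
      borel_measurable_const) (auto intro!: measurable_component_singleton[of _ _ "\<lambda>_. gauss", simplified])

lemma energy_Suc:
  "energy \<phi> (Suc n) (x(Suc n := y)) = energy \<phi> n x + (y + \<phi> * x n)\<^sup>2"
proof -
  have "(\<Sum>k = 1..n. ((x(Suc n := y)) k + \<phi> * (x(Suc n := y)) (k - 1))\<^sup>2) =
        (\<Sum>k = 1..n. (x k + \<phi> * x (k - 1))\<^sup>2)"
    by (rule sum.cong) auto
  then show ?thesis
    by (simp add: energy_def)
qed

text \<open>One step of the transfer operator: integrating the noise variable \<open>u\<close> with index \<open>n\<close> against
  \<open>exp (d u\<^sup>2 + \<mu> (y + \<phi> u)\<^sup>2)\<close> leaves a multiple of the exponential of a quadratic monomial in \<open>y\<close>.  The
  coefficient follows a Riccati recursion.  The test function \<open>h\<close> of the last noise variable is what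
  makes the induction work: it becomes the integrand of the next step.\<close>
lemma energy_transfer:
  fixes \<phi> \<mu> :: real and c d :: "nat \<Rightarrow> real"
  assumes start: "c 0 = 1" "d 0 = 0"
    and c: "\<And>n. 0 \<le> c n"
    and small: "\<And>n. 0 < 1 - 2 * \<mu> * \<phi>\<^sup>2 - 2 * d n"
    and step_c: "\<And>n. c (Suc n) = c n / sqrt (1 - 2 * \<mu> * \<phi>\<^sup>2 - 2 * d n)"
    and step_d: "\<And>n. d (Suc n) = \<mu> + 2 * \<mu>\<^sup>2 * \<phi>\<^sup>2 / (1 - 2 * \<mu> * \<phi>\<^sup>2 - 2 * d n)"
    and h: "h \<in> borel_measurable borel"
  shows "(\<integral>\<^sup>+x. ennreal (exp (\<mu> * energy \<phi> n x)) * h (x n) \<partial>PiM {..n} (\<lambda>_. gauss)) =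
     ennreal (c n) * (\<integral>\<^sup>+y. ennreal (exp (d n * y\<^sup>2)) * h y \<partial>gauss)"
  using h
proof (induction n arbitrary: h)
  case 0
  have [simp]: "{..0::nat} = {0}" by auto
  have "(\<integral>\<^sup>+x. h (x 0) \<partial>PiM {0::nat} (\<lambda>_. gauss)) = (\<integral>\<^sup>+y. h y \<partial>gauss)"
    using 0 by (intro gauss_seq.product_nn_integral_singleton) simp
  then show ?case
    using start by (simp add: energy_def)
next
  case (Suc n)
  note [measurable] = Suc.prems
  have ins: "{..Suc n} = insert (Suc n) {..n}" by auto
  have gint: "(\<integral>\<^sup>+u. ennreal (exp (d n * u\<^sup>2)) * ennreal (exp (\<mu> * (y + \<phi> * u)\<^sup>2)) \<partial>gauss) =
      ennreal (exp (d (Suc n) * y\<^sup>2) / sqrt (1 - 2 * \<mu> * \<phi>\<^sup>2 - 2 * d n))" for y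
  proof -
    have "(\<integral>\<^sup>+u. ennreal (exp (d n * u\<^sup>2)) * ennreal (exp (\<mu> * (y + \<phi> * u)\<^sup>2)) \<partial>gauss) =
       (\<integral>\<^sup>+u. ennreal (exp (\<mu> * y\<^sup>2)) * ennreal (exp ((d n + \<mu> * \<phi>\<^sup>2) * u\<^sup>2 + (2 * \<mu> * \<phi> * y) * u)) \<partial>gauss)"
      by (intro nn_integral_cong)
         (simp add: power2_eq_square algebra_simps flip: ennreal_mult exp_add)
    also have "\<dots> = ennreal (exp (\<mu> * y\<^sup>2)) *
        (\<integral>\<^sup>+u. ennreal (exp ((d n + \<mu> * \<phi>\<^sup>2) * u\<^sup>2 + (2 * \<mu> * \<phi> * y) * u)) \<partial>gauss)"
      by (rule nn_integral_cmult) measurable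
    also have "(\<integral>\<^sup>+u. ennreal (exp ((d n + \<mu> * \<phi>\<^sup>2) * u\<^sup>2 + (2 * \<mu> * \<phi> * y) * u)) \<partial>gauss) =
        ennreal (exp ((2 * \<mu> * \<phi> * y)\<^sup>2 / (2 * (1 - 2 * (d n + \<mu> * \<phi>\<^sup>2)))) / sqrt (1 - 2 * (d n + \<mu> * \<phi>\<^sup>2)))"
      unfolding gauss_def by (rule nn_integral_gaussian) (use small[of n] in simp)
    also have "ennreal (exp (\<mu> * y\<^sup>2)) * \<dots> = ennreal (exp (\<mu> * y\<^sup>2 +
        (2 * \<mu> * \<phi> * y)\<^sup>2 / (2 * (1 - 2 * (d n + \<mu> * \<phi>\<^sup>2)))) / sqrt (1 - 2 * (d n + \<mu> * \<phi>\<^sup>2)))"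
      using small[of n] by (simp add: exp_add flip: ennreal_mult)
    also have "\<mu> * y\<^sup>2 + (2 * \<mu> * \<phi> * y)\<^sup>2 / (2 * (1 - 2 * (d n + \<mu> * \<phi>\<^sup>2))) = d (Suc n) * y\<^sup>2"
    proof -
      have eq: "1 - 2 * (d n + \<mu> * \<phi>\<^sup>2) = 1 - 2 * \<mu> * \<phi>\<^sup>2 - 2 * d n" by simp
      have "(2 * \<mu> * \<phi> * y)\<^sup>2 / (2 * D) = 2 * \<mu>\<^sup>2 * \<phi>\<^sup>2 / D * y\<^sup>2" for D
        by (simp add: power_mult_distrib)
      then show ?thesis
        unfolding step_d eq by (simp only: distrib_right)
    qed
    finally show ?thesis by (simp add: algebra_simps)
  qed
  have "(\<integral>\<^sup>+x. ennreal (exp (\<mu> * energy \<phi> (Suc n) x)) * h (x (Suc n)) \<partial>PiM {..Suc n} (\<lambda>_. gauss)) =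
     (\<integral>\<^sup>+y. (\<integral>\<^sup>+x. ennreal (exp (\<mu> * energy \<phi> (Suc n) (x(Suc n := y)))) * h ((x(Suc n := y)) (Suc n))
        \<partial>PiM {..n} (\<lambda>_. gauss)) \<partial>gauss)"
    unfolding ins
    by (rule gauss_seq.product_nn_integral_insert_rev) (simp_all add: ins[symmetric])
  also have "\<dots> = (\<integral>\<^sup>+y. (\<integral>\<^sup>+x. h y * (ennreal (exp (\<mu> * energy \<phi> n x)) * ennreal (exp (\<mu> * (y + \<phi> * x n)\<^sup>2)))
        \<partial>PiM {..n} (\<lambda>_. gauss)) \<partial>gauss)"
    unfolding energy_Suc by (intro nn_integral_cong)
      (simp add: algebra_simps exp_add flip: ennreal_mult)
  also have "\<dots> = (\<integral>\<^sup>+y. h y * (\<integral>\<^sup>+x. ennreal (exp (\<mu> * energy \<phi> n x)) * ennreal (exp (\<mu> * (y + \<phi> * x n)\<^sup>2))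
        \<partial>PiM {..n} (\<lambda>_. gauss)) \<partial>gauss)"
    by (intro nn_integral_cong nn_integral_cmult) measurable
  also have "\<dots> = (\<integral>\<^sup>+y. h y * (ennreal (c n) * ennreal (exp (d (Suc n) * y\<^sup>2) / sqrt (1 - 2 * \<mu> * \<phi>\<^sup>2 - 2 * d n))) \<partial>gauss)"
    by (subst Suc.IH) (simp_all add: gint)
  also have "\<dots> = (\<integral>\<^sup>+y. ennreal (c (Suc n)) * (ennreal (exp (d (Suc n) * y\<^sup>2)) * h y) \<partial>gauss)"
  proof (intro nn_integral_cong)
    fix y
    have "ennreal (c n) * ennreal (exp (d (Suc n) * y\<^sup>2) / sqrt (1 - 2 * \<mu> * \<phi>\<^sup>2 - 2 * d n)) =
      ennreal (c (Suc n)) * ennreal (exp (d (Suc n) * y\<^sup>2))"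
      using c[of n] c[of "Suc n"] small[of n] by (simp add: step_c flip: ennreal_mult)
    then show "h y * (ennreal (c n) * ennreal (exp (d (Suc n) * y\<^sup>2) / sqrt (1 - 2 * \<mu> * \<phi>\<^sup>2 - 2 * d n))) =
      ennreal (c (Suc n)) * (ennreal (exp (d (Suc n) * y\<^sup>2)) * h y)"
      by (simp add: mult_ac)
  qed
  also have "\<dots> = ennreal (c (Suc n)) * (\<integral>\<^sup>+y. ennreal (exp (d (Suc n) * y\<^sup>2)) * h y \<partial>gauss)"
    by (rule nn_integral_cmult) measurable
  finally show ?case .
qed



text \<open>In the parameter \<open>s\<close> the Riccati recursion of \<open>energy_transfer\<close> is linearised.  Its solution is
  the quotient of two combinations of \<open>1\<close> and \<open>q ^ n\<close>: \<open>1 - 2 d n = Q n / P n\<close>.  The expression under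
  the square root is the determinant of the identity minus \<open>2 tilt \<phi> s\<close> times the tridiagonal Toeplitz
  covariance matrix of the process.\<close>
lemma nn_integral_exp_energy:
  assumes adm: "admissible \<phi> s"
  shows "(\<integral>\<^sup>+x. ennreal (exp (tilt \<phi> s * energy \<phi> n x)) \<partial>PiM {..n} (\<lambda>_. gauss)) =
    ennreal (1 / sqrt ((1 - (s\<^sup>2 * \<phi>\<^sup>2) ^ Suc n) / ((1 - s\<^sup>2 * \<phi>\<^sup>2) * ((1 + s) * (1 + s * \<phi>\<^sup>2)) ^ n)))"
proof -
  define p q E P Q where "p = \<phi>\<^sup>2" and "q = s\<^sup>2 * p" and "E = (1 + s) * (1 + s * p)"
    and "P n = (1 + s) - s * (1 + s * p) * q ^ n" and "Q n = 1 - q ^ Suc n" for n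
  define c d where "c n = 1 / sqrt (P n / ((1 - q) * E ^ n))" and "d n = (1 - Q n / P n) / 2" for n
  have pos: "0 < 1 + s" "0 < 1 + s * p" "0 < 1 - q" "0 < E" "0 \<le> q"
    using admissible_pos[OF adm] by (auto simp: p_def q_def E_def)
  have mu: "tilt \<phi> s = s / (2 * E)"
    by (simp add: tilt_def E_def p_def)
  have qn: "0 \<le> q ^ n" "q ^ n \<le> 1" "q ^ Suc n < 1" for n
    using pos power_decreasing[of 1 "Suc n" q] by (auto intro!: power_le_one)
  have Q: "0 < Q n" for n
    using qn[of n] by (simp add: Q_def)
  have P: "0 < P n" for n
  proof (cases "0 \<le> s")
    case True
    then have "s * (1 + s * p) * q ^ n \<le> s * (1 + s * p) * 1"
      using qn[of n] pos by (intro mult_left_mono) auto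
    also have "\<dots> = s + q" by (simp add: q_def power2_eq_square algebra_simps)
    finally show ?thesis
      using pos by (simp add: P_def)
  next
    case False
    then have "s * (1 + s * p) * q ^ n \<le> 0"
      using qn[of n] pos by (intro mult_nonpos_nonneg) auto
    then show ?thesis
      using pos by (simp add: P_def)
  qed
  have step: "1 - 2 * (s / (2 * E)) * p - 2 * d n = P (Suc n) / (E * P n)" for n
  proof -
    have "(E - s * p) * P n - E * (P n - Q n) = P (Suc n)"
      unfolding P_def Q_def E_def by (simp add: q_def) algebra
    then show ?thesis
      using pos P[of n] by (simp add: d_def divide_simps) (simp add: algebra_simps)
  qed
  have "(\<integral>\<^sup>+x. ennreal (exp (tilt \<phi> s * energy \<phi> n x)) * 1 \<partial>PiM {..n} (\<lambda>_. gauss)) =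
     ennreal (c n) * (\<integral>\<^sup>+y. ennreal (exp (d n * y\<^sup>2)) * 1 \<partial>gauss)"
    unfolding mu
  proof (rule energy_transfer, unfold p_def[symmetric])
    show "c 0 = 1"
      using pos by (simp add: c_def P_def q_def power2_eq_square algebra_simps)
    show "d 0 = 0"
      using pos P[of 0] by (simp add: d_def P_def Q_def q_def power2_eq_square algebra_simps)
    show "0 \<le> c n" for n
      using pos P[of n] by (simp add: c_def)
    show "0 < 1 - 2 * (s / (2 * E)) * p - 2 * d n" for n
      unfolding step using pos P[of n] P[of "Suc n"] by simp
    show "c (Suc n) = c n / sqrt (1 - 2 * (s / (2 * E)) * p - 2 * d n)" for n
      unfolding step using pos P[of n] P[of "Suc n"]
      by (simp add: c_def flip: real_sqrt_mult real_sqrt_divide)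
    show "d (Suc n) = s / (2 * E) + 2 * (s / (2 * E))\<^sup>2 * p / (1 - 2 * (s / (2 * E)) * p - 2 * d n)" for n
    proof -
      have "E * Q (Suc n) = (E - s) * P (Suc n) - q * P n"
        unfolding P_def Q_def E_def by (simp add: q_def) algebra
      then have "1 - Q (Suc n) / P (Suc n) = s / E + q * P n / (E * P (Suc n))"
        using pos P[of "Suc n"] by (simp add: divide_simps) algebra
      moreover have "2 * (s / (2 * E))\<^sup>2 * p / (P (Suc n) / (E * P n)) = q * P n / (E * P (Suc n)) / 2"
        using pos P[of n] P[of "Suc n"] by (simp add: q_def power2_eq_square divide_simps)
      ultimately show ?thesis
        unfolding step by (simp add: d_def)
    qed
  qed simp
  also have "(\<integral>\<^sup>+y. ennreal (exp (d n * y\<^sup>2)) * 1 \<partial>gauss) = ennreal (1 / sqrt (1 - 2 * d n))"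
    using nn_integral_gaussian[of "d n" 0] Q[of n] P[of n] by (simp add: gauss_def d_def)
  also have "ennreal (c n) * ennreal (1 / sqrt (1 - 2 * d n)) = ennreal (1 / sqrt (Q n / ((1 - q) * E ^ n)))"
  proof -
    have "P n / ((1 - q) * E ^ n) * (1 - 2 * d n) = Q n / ((1 - q) * E ^ n)"
      using P[of n] by (simp add: d_def diff_divide_distrib)
    then have "c n * (1 / sqrt (1 - 2 * d n)) = 1 / sqrt (Q n / ((1 - q) * E ^ n))"
      unfolding c_def times_divide_times_eq real_sqrt_mult[symmetric] by (simp only: mult_1)
    moreover have "0 \<le> c n" "0 \<le> 1 / sqrt (1 - 2 * d n)"
      using pos P[of n] Q[of n] by (simp_all add: c_def d_def)
    ultimately show ?thesis
      by (simp flip: ennreal_mult)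
  qed
  finally show ?thesis
    by (simp add: Q_def q_def p_def E_def)
qed

lemma distr_gaussian_noise:
  fixes \<epsilon> :: "nat \<Rightarrow> 'a \<Rightarrow> real"
  assumes "prob_space M" and "prob_space.indep_vars M (\<lambda>_. borel) \<epsilon> UNIV"
    and dist: "\<And>n. distributed M lborel (\<epsilon> n) (normal_density 0 1)"
  shows "distr M (PiM {..n} (\<lambda>_. borel)) (\<lambda>\<omega>. restrict (\<lambda>k. \<epsilon> k \<omega>) {..n}) = PiM {..n} (\<lambda>_. gauss)"
proof -
  interpret prob_space M by fact
  have d: "distr M borel (\<epsilon> k) = gauss" for k
    using distributed_distr_eq_density[OF dist[of k]]
    by (simp add: gauss_def cong: distr_cong)
  have "random_variable borel (\<epsilon> k)" for k
    using distributed_measurable[OF dist[of k]] by simp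
  moreover have "indep_vars (\<lambda>_. borel) \<epsilon> {..n}"
    using assms(2) by (rule indep_vars_subset) simp
  ultimately have "distr M (PiM {..n} (\<lambda>_. borel)) (\<lambda>\<omega>. restrict (\<lambda>k. \<epsilon> k \<omega>) {..n}) =
     PiM {..n} (\<lambda>k. distr M borel (\<epsilon> k))"
    by (subst indep_vars_iff_distr_eq_PiM[symmetric]) auto
  then show ?thesis
    by (simp add: d)
qed

lemma MA1_energy_mgf:
  fixes \<epsilon> :: "nat \<Rightarrow> 'a \<Rightarrow> real"
  assumes "prob_space M" and "prob_space.indep_vars M (\<lambda>_. borel) \<epsilon> UNIV"
    and dist: "\<And>n. distributed M lborel (\<epsilon> n) (normal_density 0 1)"
    and adm: "admissible \<phi> s"
  shows "has_bochner_integral M (\<lambda>\<omega>. exp (tilt \<phi> s * energy \<phi> n (\<lambda>k. \<epsilon> k \<omega>)))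
    (1 / sqrt ((1 - (s\<^sup>2 * \<phi>\<^sup>2) ^ Suc n) / ((1 - s\<^sup>2 * \<phi>\<^sup>2) * ((1 + s) * (1 + s * \<phi>\<^sup>2)) ^ n)))"
proof (rule has_bochner_integral_nn_integral)
  have [measurable]: "\<epsilon> k \<in> borel_measurable M" for k
    using distributed_measurable[OF dist[of k]] by simp
  show "(\<lambda>\<omega>. exp (tilt \<phi> s * energy \<phi> n (\<lambda>k. \<epsilon> k \<omega>))) \<in> borel_measurable M"
    unfolding energy_def by measurable
  have "energy \<phi> n (\<lambda>k. \<epsilon> k \<omega>) = energy \<phi> n (restrict (\<lambda>k. \<epsilon> k \<omega>) {..n})" for \<omega>
    unfolding energy_def by (intro sum.cong) auto
  then have "(\<integral>\<^sup>+\<omega>. ennreal (exp (tilt \<phi> s * energy \<phi> n (\<lambda>k. \<epsilon> k \<omega>))) \<partial>M) =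
      (\<integral>\<^sup>+\<omega>. ennreal (exp (tilt \<phi> s * energy \<phi> n (restrict (\<lambda>k. \<epsilon> k \<omega>) {..n}))) \<partial>M)"
    by simp
  also have "\<dots> = (\<integral>\<^sup>+x. ennreal (exp (tilt \<phi> s * energy \<phi> n x))
      \<partial>distr M (PiM {..n} (\<lambda>_. borel)) (\<lambda>\<omega>. restrict (\<lambda>k. \<epsilon> k \<omega>) {..n}))"
    using measurable_energy[of \<phi> n]
    by (subst nn_integral_distr) (auto intro!: measurable_restrict simp: cong: measurable_cong_sets sets_PiM_cong)
  also have "\<dots> = (\<integral>\<^sup>+x. ennreal (exp (tilt \<phi> s * energy \<phi> n x)) \<partial>PiM {..n} (\<lambda>_. gauss))"
    using distr_gaussian_noise[OF assms(1-3)] by simp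
  finally show "(\<integral>\<^sup>+\<omega>. ennreal (exp (tilt \<phi> s * energy \<phi> n (\<lambda>k. \<epsilon> k \<omega>))) \<partial>M) =
    ennreal (1 / sqrt ((1 - (s\<^sup>2 * \<phi>\<^sup>2) ^ Suc n) / ((1 - s\<^sup>2 * \<phi>\<^sup>2) * ((1 + s) * (1 + s * \<phi>\<^sup>2)) ^ n)))"
    using nn_integral_exp_energy[OF adm, of n] by simp
  show "0 \<le> 1 / sqrt ((1 - (s\<^sup>2 * \<phi>\<^sup>2) ^ Suc n) / ((1 - s\<^sup>2 * \<phi>\<^sup>2) * ((1 + s) * (1 + s * \<phi>\<^sup>2)) ^ n))"
    using admissible_pos[OF adm] power_le_one[of "s\<^sup>2 * \<phi>\<^sup>2" "Suc n"] by simp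
qed auto

section \<open>The limiting cumulant generating function\<close>

text \<open>The mean of \<open>- 1/2 ln (1 - 2 l (1 + \<phi>\<^sup>2 + 2 \<phi> cos \<theta>))\<close> over the circle, evaluated.\<close>
definition cgf :: "real \<Rightarrow> real \<Rightarrow> real" where
  "cgf \<phi> l = - (1 / 2 *
     ln ((1 - 2 * l * (1 + \<phi>\<^sup>2) + sqrt ((1 - 2 * l * (1 + \<phi>\<^sup>2))\<^sup>2 - 16 * l\<^sup>2 * \<phi>\<^sup>2)) / 2))"

text \<open>The condition is \<open>1 - 2 l (1 + \<phi>\<^sup>2 + 2 \<phi> cos \<theta>) > 0\<close> for all \<open>\<theta>\<close>.\<close>
definition tilts :: "real \<Rightarrow> real set" where
  "tilts \<phi> = {l. 4 * \<bar>l * \<phi>\<bar> < 1 - 2 * l * (1 + \<phi>\<^sup>2)}"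

lemma open_tilts: "open (tilts \<phi>)"
  unfolding tilts_def by (intro open_Collect_less continuous_intros)

lemma zero_in_tilts: "0 \<in> tilts \<phi>"
  by (simp add: tilts_def)

lemma tilt_spectral:
  assumes adm: "admissible \<phi> s"
  defines "\<kappa> \<equiv> 1 / ((1 + s) * (1 + s * \<phi>\<^sup>2))" and "q \<equiv> s\<^sup>2 * \<phi>\<^sup>2"
  shows "1 - 2 * tilt \<phi> s * (1 + \<phi>\<^sup>2) = \<kappa> * (1 + q)"
    and "16 * (tilt \<phi> s)\<^sup>2 * \<phi>\<^sup>2 = 4 * \<kappa>\<^sup>2 * q"
    and "sqrt ((1 - 2 * tilt \<phi> s * (1 + \<phi>\<^sup>2))\<^sup>2 - 16 * (tilt \<phi> s)\<^sup>2 * \<phi>\<^sup>2) = \<kappa> * (1 - q)"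
proof -
  note pos = admissible_pos[OF adm]
  have l: "tilt \<phi> s = \<kappa> * s / 2"
    by (simp add: tilt_def \<kappa>_def)
  have k: "\<kappa> * ((1 + s) * (1 + s * \<phi>\<^sup>2)) = 1"
    using pos by (simp add: \<kappa>_def)
  show a: "1 - 2 * tilt \<phi> s * (1 + \<phi>\<^sup>2) = \<kappa> * (1 + q)"
    using k unfolding l q_def by algebra
  show b: "16 * (tilt \<phi> s)\<^sup>2 * \<phi>\<^sup>2 = 4 * \<kappa>\<^sup>2 * q"
    unfolding l q_def by (simp add: power_mult_distrib power_divide)
  have "(\<kappa> * (1 + q))\<^sup>2 - 4 * \<kappa>\<^sup>2 * q = (\<kappa> * (1 - q))\<^sup>2"
    by algebra
  moreover have "0 \<le> \<kappa> * (1 - q)"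
    using pos by (simp add: \<kappa>_def q_def)
  ultimately show "sqrt ((1 - 2 * tilt \<phi> s * (1 + \<phi>\<^sup>2))\<^sup>2 - 16 * (tilt \<phi> s)\<^sup>2 * \<phi>\<^sup>2) = \<kappa> * (1 - q)"
    unfolding a b by simp
qed

lemma cgf_tilt:
  assumes "admissible \<phi> s"
  shows "cgf \<phi> (tilt \<phi> s) = ln ((1 + s) * (1 + s * \<phi>\<^sup>2)) / 2"
proof -
  have "1 / ((1 + s) * (1 + s * \<phi>\<^sup>2)) * (1 + s\<^sup>2 * \<phi>\<^sup>2) + 1 / ((1 + s) * (1 + s * \<phi>\<^sup>2)) * (1 - s\<^sup>2 * \<phi>\<^sup>2) =
      2 * inverse ((1 + s) * (1 + s * \<phi>\<^sup>2))"
    by (simp add: inverse_eq_divide add_divide_distrib[symmetric])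
  then have "cgf \<phi> (tilt \<phi> s) = - (1 / 2 * ln (inverse ((1 + s) * (1 + s * \<phi>\<^sup>2))))"
    unfolding cgf_def tilt_spectral(3)[OF assms] unfolding tilt_spectral(1)[OF assms] by simp
  then show ?thesis
    using admissible_pos(7)[OF assms] by (simp only: ln_inverse)
qed

lemma tilt_in_tilts:
  assumes adm: "admissible \<phi> s"
  shows "tilt \<phi> s \<in> tilts \<phi>"
proof -
  define \<kappa> where "\<kappa> = 1 / ((1 + s) * (1 + s * \<phi>\<^sup>2))"
  have k: "0 < \<kappa>"
    using admissible_pos[OF adm] by (simp add: \<kappa>_def)
  have "\<bar>s * \<phi>\<bar> \<noteq> 1"
    using admissible_pos(3)[OF adm] by (metis abs_square_eq_1 diff_self less_irrefl power_mult_distrib)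
  then have "0 < (1 - \<bar>s * \<phi>\<bar>)\<^sup>2"
    by simp
  then have "2 * \<bar>s * \<phi>\<bar> < 1 + s\<^sup>2 * \<phi>\<^sup>2"
    by (simp add: power2_diff flip: power_mult_distrib)
  then have "\<kappa> * (2 * \<bar>s * \<phi>\<bar>) < \<kappa> * (1 + s\<^sup>2 * \<phi>\<^sup>2)"
    using k by simp
  moreover have "4 * \<bar>tilt \<phi> s * \<phi>\<bar> = \<kappa> * (2 * \<bar>s * \<phi>\<bar>)"
  proof -
    have l: "tilt \<phi> s = \<kappa> * s / 2"
      by (simp add: tilt_def \<kappa>_def)
    show ?thesis
      unfolding l using k by (simp add: abs_mult)
  qed
  ultimately show ?thesis
    using tilt_spectral(1)[OF adm] by (simp add: tilts_def \<kappa>_def)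
qed

text \<open>The larger root \<open>\<kappa>\<close> of \<open>\<kappa>\<^sup>2 - a \<kappa> + 4 l\<^sup>2 \<phi>\<^sup>2 = 0\<close> determines \<open>s = 2 l / \<kappa>\<close>.  The product of the roots is
  \<open>\<kappa>\<^sup>2 q\<close>, which is why the larger one makes \<open>q < 1\<close>.\<close>
lemma tilts_cases:
  assumes "-1 < \<phi>" "\<phi> < 1" "l \<in> tilts \<phi>"
  shows "\<exists>s. admissible \<phi> s \<and> l = tilt \<phi> s"
proof -
  define a b \<kappa> s where "a = 1 - 2 * l * (1 + \<phi>\<^sup>2)" and "b = 4 * \<bar>l * \<phi>\<bar>"
    and "\<kappa> = (a + sqrt (a\<^sup>2 - b\<^sup>2)) / 2" and "s = 2 * l / \<kappa>"
  have ab: "0 \<le> b" "b < a"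
    using assms(3) by (auto simp: tilts_def a_def b_def)
  have D: "0 < a\<^sup>2 - b\<^sup>2"
    using ab by (simp add: power_strict_mono)
  have k: "a / 2 < \<kappa>" "0 < \<kappa>"
    using ab D by (auto simp: \<kappa>_def add_pos_pos)
  have b2: "b\<^sup>2 = 16 * l\<^sup>2 * \<phi>\<^sup>2"
    by (simp add: b_def power_mult_distrib)
  have "2 * \<kappa> = a + sqrt (a\<^sup>2 - b\<^sup>2)"
    by (simp add: \<kappa>_def)
  then have "(2 * \<kappa> - a)\<^sup>2 = a\<^sup>2 - b\<^sup>2"
    using D by simp
  then have quad: "\<kappa>\<^sup>2 - a * \<kappa> + 4 * l\<^sup>2 * \<phi>\<^sup>2 = 0"
    unfolding b2 by algebra
  have ks: "\<kappa> * s = 2 * l"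
    using k by (simp add: s_def)
  have q: "\<kappa>\<^sup>2 * (s\<^sup>2 * \<phi>\<^sup>2) = 4 * l\<^sup>2 * \<phi>\<^sup>2"
    using ks by algebra
  have "b\<^sup>2 / 4 < \<kappa>\<^sup>2"
    using power_strict_mono[of "b / 2" \<kappa> 2] ab k by (simp add: power_divide)
  then have "\<kappa>\<^sup>2 * (s\<^sup>2 * \<phi>\<^sup>2) < \<kappa>\<^sup>2 * 1"
    unfolding q b2 by (simp add: mult_ac)
  then have q1: "s\<^sup>2 * \<phi>\<^sup>2 < 1"
    using k by simp
  have "\<kappa> * (\<kappa> * ((1 + s) * (1 + s * \<phi>\<^sup>2)) - 1) = 0"
    using quad ks unfolding a_def by algebra
  then have one: "\<kappa> * ((1 + s) * (1 + s * \<phi>\<^sup>2)) = 1"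
    using k by simp
  then have E: "0 < (1 + s) * (1 + s * \<phi>\<^sup>2)"
    using k by (metis zero_less_mult_pos zero_less_one)
  have "\<bar>s * \<phi>\<bar> < 1"
    using q1 by (metis abs_square_less_1 power_mult_distrib)
  then have "\<bar>s * \<phi>\<bar> * \<bar>\<phi>\<bar> < 1 * 1"
    using assms by (intro mult_strict_mono') auto
  then have "0 < 1 + s * \<phi>\<^sup>2"
    by (simp add: power2_eq_square abs_mult[symmetric] mult.assoc abs_less_iff)
  then have "-1 < s"
    using E by (simp add: zero_less_mult_iff)
  then have adm: "admissible \<phi> s"
    using assms q1 by (simp add: admissible_def)
  have "2 * l * ((1 + s) * (1 + s * \<phi>\<^sup>2)) = s"
    using one ks by algebra
  then have "l = tilt \<phi> s"
    using E by (simp add: tilt_def field_simps)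
  then show ?thesis
    using adm by blast
qed

lemma cgf_has_derivative:
  assumes adm: "admissible \<phi> s"
  shows "(cgf \<phi> has_real_derivative mean \<phi> s) (at (tilt \<phi> s))"
proof -
  define l where "l = tilt \<phi> s"
  define a r where "a = 1 - 2 * l * (1 + \<phi>\<^sup>2)" and "r = sqrt (a\<^sup>2 - 16 * l\<^sup>2 * \<phi>\<^sup>2)"
  define E q where "E = (1 + s) * (1 + s * \<phi>\<^sup>2)" and "q = s\<^sup>2 * \<phi>\<^sup>2"
  have pos: "0 < E" "0 < 1 - q"
    using admissible_pos[OF adm] by (auto simp: E_def q_def)
  have ar: "a = 1 / E * (1 + q)" "r = 1 / E * (1 - q)"
    using tilt_spectral(1,3)[OF adm] by (simp_all add: a_def r_def l_def E_def q_def)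
  then have "0 < r" "a + r = 2 / E"
    using pos by (simp_all add: add_divide_distrib[symmetric])
  then have D: "0 < a\<^sup>2 - 16 * l\<^sup>2 * \<phi>\<^sup>2"
    by (simp add: r_def)
  have "(cgf \<phi> has_real_derivative
      - (1 / 2 * (((- (2 * (1 + \<phi>\<^sup>2)) + (2 * a * - (2 * (1 + \<phi>\<^sup>2)) - 32 * l * \<phi>\<^sup>2) / (2 * r)) / 2) / ((a + r) / 2)))) (at l)"
    unfolding cgf_def[abs_def] using D \<open>0 < r\<close> \<open>a + r = 2 / E\<close> pos
    by (auto intro!: derivative_eq_intros simp: a_def[symmetric] r_def[symmetric])
       (simp add: field_simps a_def)
  moreover have "- (1 / 2 * (((- (2 * (1 + \<phi>\<^sup>2)) + (2 * a * - (2 * (1 + \<phi>\<^sup>2)) - 32 * l * \<phi>\<^sup>2) / (2 * r)) / 2) / ((a + r) / 2))) = mean \<phi> s"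
  proof -
    have l: "l = s / (2 * E)"
      by (simp add: l_def tilt_def E_def)
    have "- (1 / 2 * (((- (2 * (1 + \<phi>\<^sup>2)) + (2 * a * - (2 * (1 + \<phi>\<^sup>2)) - 32 * l * \<phi>\<^sup>2) / (2 * r)) / 2) / ((a + r) / 2))) =
       ((1 + \<phi>\<^sup>2) * (1 - q) + (1 + \<phi>\<^sup>2) * (1 + q) + 4 * s * \<phi>\<^sup>2) * E / (2 * (1 - q))"
      unfolding \<open>a + r = 2 / E\<close> unfolding ar l using pos by (simp add: field_simps)
    also have "\<dots> = (1 + \<phi>\<^sup>2 + 2 * s * \<phi>\<^sup>2) * E / (1 - q)"
      using pos by (simp add: field_simps)
    also have "\<dots> = mean \<phi> s"
      by (simp add: mean_def E_def q_def mult.assoc)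
    finally show ?thesis .
  qed
  ultimately show ?thesis
    by (simp add: l_def)
qed

lemma deriv_cgf_tilt: "admissible \<phi> s \<Longrightarrow> deriv (cgf \<phi>) (tilt \<phi> s) = mean \<phi> s"
  by (rule DERIV_imp_deriv) (rule cgf_has_derivative)

text \<open>The mean vanishes at \<open>s = -1\<close>.  It is unbounded above because \<open>q\<close> can approach \<open>1\<close>, or
  \<open>s\<close> can grow without bound when \<open>\<phi> = 0\<close>.\<close>
lemma mean_surj:
  assumes "-1 < \<phi>" "\<phi> < 1" "0 < x"
  shows "\<exists>s. admissible \<phi> s \<and> mean \<phi> s = x"
proof -
  have p: "\<phi>\<^sup>2 < 1"
    using assms by (auto simp: abs_square_less_1)
  obtain t where t: "0 \<le> t" "t\<^sup>2 * \<phi>\<^sup>2 < 1" "x \<le> mean \<phi> t"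
  proof (cases "\<phi> = 0")
    case True
    then show ?thesis
      using that[of x] assms by (simp add: mean_def)
  next
    case False
    \<comment> \<open>chosen so that \<open>1 / (1 - t\<^sup>2 \<phi>\<^sup>2) = 1 + x\<close>, while the numerator of the mean is at least \<open>1\<close>\<close>
    define t where "t = sqrt ((1 - 1 / (1 + x)) / \<phi>\<^sup>2)"
    have t: "0 \<le> t" "t\<^sup>2 * \<phi>\<^sup>2 = 1 - 1 / (1 + x)"
      using False assms by (auto simp: t_def)
    have "1 * 1 * 1 \<le> (1 + \<phi>\<^sup>2 + 2 * t * \<phi>\<^sup>2) * (1 + t) * (1 + t * \<phi>\<^sup>2)"
      using t(1) by (intro mult_mono) auto
    from mult_right_mono[OF this, of "1 + x"] have "1 + x \<le> mean \<phi> t"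
      using assms by (simp add: mean_def t(2))
    then have "x \<le> mean \<phi> t"
      by simp
    then show ?thesis
      using that[of t] t assms by simp
  qed
  have q: "s\<^sup>2 * \<phi>\<^sup>2 < 1" if "-1 \<le> s" "s \<le> t" for s
  proof (cases "0 \<le> s")
    case True
    then have "s\<^sup>2 * \<phi>\<^sup>2 \<le> t\<^sup>2 * \<phi>\<^sup>2"
      using that by (intro mult_right_mono power_mono) auto
    then show ?thesis using t by simp
  next
    case False
    then have "s\<^sup>2 * \<phi>\<^sup>2 \<le> 1 * \<phi>\<^sup>2"
      using that by (intro mult_right_mono) (auto simp: abs_square_le_1)
    then show ?thesis using p by simp
  qed
  have "continuous_on {-1..t} (mean \<phi>)"
    unfolding mean_def[abs_def] using q by (intro continuous_intros) fastforce
  then obtain s where s: "-1 \<le> s" "s \<le> t" "mean \<phi> s = x"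
    using IVT'[of "mean \<phi>" "-1" x t] t assms by (auto simp: mean_def)
  have "s \<noteq> -1"
    using s(3) assms by (auto simp: mean_def)
  then show ?thesis
    using s q[of s] assms by (intro exI[of _ s]) (auto simp: admissible_def)
qed

text \<open>For \<open>x \<le> 0\<close> a tilt tending to \<open>- \<infinity>\<close>, that is \<open>s\<close> tending to \<open>-1\<close>, makes \<open>- cgf\<close>
  arbitrarily large.\<close>
lemma Legendre_cgf_nonpos:
  assumes "-1 < \<phi>" "\<phi> < 1" "x \<le> 0"
  shows "Legendre (tilts \<phi>) (cgf \<phi>) x = \<infinity>"
proof (rule ereal_top)
  fix b :: real
  define t where "t = min (1 / 2) (exp (- (2 * b)))"
  define s where "s = t - 1"
  have t: "0 < t" "t \<le> 1 / 2" "t \<le> exp (- (2 * b))"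
    by (auto simp: t_def)
  have "\<phi>\<^sup>2 < 1"
    using assms by (auto simp: abs_square_less_1)
  moreover have "s\<^sup>2 * \<phi>\<^sup>2 \<le> 1 * \<phi>\<^sup>2"
    using t by (intro mult_right_mono) (auto simp: abs_square_le_1 s_def)
  ultimately have adm: "admissible \<phi> s"
    using t assms by (auto simp: admissible_def s_def)
  note pos = admissible_pos[OF adm]
  have "s * \<phi>\<^sup>2 \<le> 0"
    using t by (intro mult_nonpos_nonneg) (auto simp: s_def)
  then have "(1 + s) * (1 + s * \<phi>\<^sup>2) \<le> t * 1"
    using t(1) pos(2) by (intro mult_mono) (auto simp: s_def)
  then have "ln ((1 + s) * (1 + s * \<phi>\<^sup>2)) \<le> ln (exp (- (2 * b)))"
    using pos t by (subst ln_le_cancel_iff) auto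
  then have "b \<le> - cgf \<phi> (tilt \<phi> s)"
    by (simp add: cgf_tilt[OF adm])
  moreover have "tilt \<phi> s \<le> 0"
    using pos t by (auto simp: tilt_def s_def intro!: divide_nonpos_pos mult_pos_pos)
  then have "0 \<le> tilt \<phi> s * x"
    using assms by (intro mult_nonpos_nonpos)
  ultimately have "ereal b \<le> ereal (tilt \<phi> s * x - cgf \<phi> (tilt \<phi> s))"
    by simp
  also have "\<dots> \<le> Legendre (tilts \<phi>) (cgf \<phi>) x"
    unfolding Legendre_def using tilt_in_tilts[OF adm] by (intro SUP_upper)
  finally show "ereal b \<le> Legendre (tilts \<phi>) (cgf \<phi>) x" .
qed

lemma log_mgf_limit:
  assumes adm: "admissible \<phi> s"
  shows "(\<lambda>n. ln (1 / sqrt ((1 - (s\<^sup>2 * \<phi>\<^sup>2) ^ Suc n) / ((1 - s\<^sup>2 * \<phi>\<^sup>2) * ((1 + s) * (1 + s * \<phi>\<^sup>2)) ^ n))) / real n)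
    \<longlonglongrightarrow> cgf \<phi> (tilt \<phi> s)"
proof -
  define E q where "E = (1 + s) * (1 + s * \<phi>\<^sup>2)" and "q = s\<^sup>2 * \<phi>\<^sup>2"
  have pos: "0 < E" "0 < 1 - q" "0 \<le> q"
    using admissible_pos[OF adm] by (auto simp: E_def q_def)
  have q0: "(\<lambda>n. q ^ Suc n) \<longlonglongrightarrow> 0"
    using pos by (intro LIMSEQ_Suc LIMSEQ_realpow_zero) auto
  then have "(\<lambda>n. ln (1 - q ^ Suc n) - ln (1 - q)) \<longlonglongrightarrow> ln (1 - 0) - ln (1 - q)"
    by (intro tendsto_intros q0) auto
  then have "(\<lambda>n. ln E / 2 - (ln (1 - q ^ Suc n) - ln (1 - q)) * (1 / real n) / 2) \<longlonglongrightarrow>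
      ln E / 2 - (ln (1 - 0) - ln (1 - q)) * 0 / 2"
    by (intro tendsto_intros lim_1_over_n q0) auto
  moreover have "eventually (\<lambda>n. ln E / 2 - (ln (1 - q ^ Suc n) - ln (1 - q)) * (1 / real n) / 2 =
      ln (1 / sqrt ((1 - q ^ Suc n) / ((1 - q) * E ^ n))) / real n) sequentially"
    using eventually_ge_at_top[of 1]
  proof eventually_elim
    case (elim n)
    have q1: "q ^ Suc n < 1"
      using pos power_decreasing[of 1 "Suc n" q] by auto
    define z where "z = (1 - q ^ Suc n) / ((1 - q) * E ^ n)"
    have z: "0 < z"
      unfolding z_def using q1 pos by (intro divide_pos_pos mult_pos_pos) auto
    have "ln ((1 - w) / ((1 - q) * E ^ n)) = ln (1 - w) - (ln (1 - q) + real n * ln E)" if "w < 1" for w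
      using that pos by (simp add: ln_div ln_mult ln_realpow)
    then have lz: "ln z = ln (1 - q ^ Suc n) - (ln (1 - q) + real n * ln E)"
      unfolding z_def using q1 .
    have "ln (1 / sqrt z) = - ln z / 2"
      using z by (simp add: ln_div ln_sqrt)
    moreover have "ln E / 2 - (a - b) * (1 / real n) / 2 = - (a - (b + real n * ln E)) / 2 / real n" for a b
      using elim by (simp add: field_simps)
    ultimately show ?case
      unfolding z_def[symmetric] lz by presburger
  qed
  ultimately show ?thesis
    using Lim_transform_eventually by (fastforce simp: cgf_tilt[OF adm] E_def[symmetric] q_def[symmetric])
qed

text \<open>That \<open>tilt \<phi> s\<close> maximises the Legendre functional at \<open>mean \<phi> s\<close> is convexity of \<open>cgf\<close>.  It is
  obtained through \<open>tangent_below\<close>, and therefore for processes that realise \<open>cgf\<close> as a limit.\<close>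
lemma Legendre_cgf_eq_K_fun:
  assumes "-1 < \<phi>" "\<phi> < 1" and "scaled_cgf M V (tilts \<phi>) (cgf \<phi>) (deriv (cgf \<phi>))"
  shows "Legendre (tilts \<phi>) (cgf \<phi>) = K_fun \<phi>"
proof
  fix x
  interpret scaled_cgf M V "tilts \<phi>" "cgf \<phi>" "deriv (cgf \<phi>)" by fact
  show "Legendre (tilts \<phi>) (cgf \<phi>) x = K_fun \<phi> x"
  proof (cases "0 < x")
    case True
    then obtain s where s: "admissible \<phi> s" "x = mean \<phi> s"
      using mean_surj[OF assms(1,2)] by blast
    have "Legendre (tilts \<phi>) (cgf \<phi>) x = ereal (tilt \<phi> s * x - cgf \<phi> (tilt \<phi> s))"
      using J_tangent[OF tilt_in_tilts[OF s(1)]] by (simp add: deriv_cgf_tilt s)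
    also have "tilt \<phi> s = lambda_fun \<phi> x"
      using lambda_fun_mean[OF s(1)] s(2) by simp
    also have "ereal (lambda_fun \<phi> x * x - cgf \<phi> (lambda_fun \<phi> x)) = K_fun \<phi> x"
      using True by (simp add: K_fun_def cgf_def mult.commute)
    finally show ?thesis .
  next
    case False
    then show ?thesis
      using Legendre_cgf_nonpos[OF assms(1,2), of x] by (simp add: K_fun_def)
  qed
qed

section \<open>The large deviation principle\<close>

theorem mainTheorem4:
  fixes M :: "'a measure"
    and \<epsilon> Y :: "nat \<Rightarrow> 'a \<Rightarrow> real"
    and \<phi> :: real
  assumes "prob_space M"
    and "-1 < \<phi>" and "\<phi> < 1"
    and "prob_space.indep_vars M (\<lambda>_. borel) \<epsilon> UNIV"
    and "\<And>n. distributed M lborel (\<epsilon> n) (normal_density 0 1)"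
    and "\<And>n \<omega>. n \<ge> 1 \<Longrightarrow> \<omega> \<in> space M \<Longrightarrow> Y n \<omega> = \<epsilon> n \<omega> + \<phi> * \<epsilon> (n - 1) \<omega>"
  shows "satisfies_LDP M (\<lambda>n \<omega>. 1 / real n * (\<Sum>k = 1..n. (Y k \<omega>)^2)) (K_fun \<phi>)
       \<and> good_rate_function (K_fun \<phi>)"
proof -
  define V where "V n \<omega> = 1 / real n * (\<Sum>k = 1..n. (Y k \<omega>)^2)" for n \<omega>
  have V: "V n \<omega> = energy \<phi> n (\<lambda>k. \<epsilon> k \<omega>) / real n" if "\<omega> \<in> space M" for n \<omega>
    unfolding V_def energy_def using assms(6)[OF _ that] by simp
  have eps: "\<epsilon> k \<in> borel_measurable M" for k
    using distributed_measurable[OF assms(5)[of k]] by simp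
  have mgf: "has_bochner_integral M (\<lambda>\<omega>. exp (real n * tilt \<phi> s * V n \<omega>))
      (1 / sqrt ((1 - (s\<^sup>2 * \<phi>\<^sup>2) ^ Suc n) / ((1 - s\<^sup>2 * \<phi>\<^sup>2) * ((1 + s) * (1 + s * \<phi>\<^sup>2)) ^ n)))"
    if "1 \<le> n" "admissible \<phi> s" for n s
    using MA1_energy_mgf[OF assms(1,4,5) that(2), of n]
    by (rule has_bochner_integral_cong[THEN iffD1, rotated -1]) (use V that(1) in \<open>auto simp: mult_ac\<close>)
  have cgf: "scaled_cgf M V (tilts \<phi>) (cgf \<phi>) (deriv (cgf \<phi>))"
  proof (intro scaled_cgf.intro scaled_cgf_axioms.intro open_tilts zero_in_tilts assms(1))
    note [measurable] = eps
    have "(\<lambda>\<omega>. energy \<phi> n (\<lambda>k. \<epsilon> k \<omega>) / real n) \<in> borel_measurable M" for n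
      unfolding energy_def by measurable
    then show "V n \<in> borel_measurable M" for n
      by (subst measurable_cong[OF V])
  next
    fix l assume "l \<in> tilts \<phi>"
    then obtain s where s: "admissible \<phi> s" "l = tilt \<phi> s"
      using tilts_cases assms(2,3) by blast
    show "(cgf \<phi> has_real_derivative deriv (cgf \<phi>) l) (at l)"
      using cgf_has_derivative[OF s(1)] by (simp add: s deriv_cgf_tilt)
    show "integrable M (\<lambda>\<omega>. exp (real n * l * V n \<omega>))" if "1 \<le> n" for n
      using mgf[OF that s(1)] unfolding s(2) by (simp add: has_bochner_integral_iff)
    have "eventually (\<lambda>n. ln (1 / sqrt ((1 - (s\<^sup>2 * \<phi>\<^sup>2) ^ Suc n) / ((1 - s\<^sup>2 * \<phi>\<^sup>2) * ((1 + s) * (1 + s * \<phi>\<^sup>2)) ^ n))) / real n =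
        ln (prob_space.expectation M (\<lambda>\<omega>. exp (real n * l * V n \<omega>))) / real n) sequentially"
      using eventually_ge_at_top[of 1]
      by eventually_elim (simp add: has_bochner_integral_integral_eq[OF mgf[OF _ s(1)]] s(2))
    then show "(\<lambda>n. ln (prob_space.expectation M (\<lambda>\<omega>. exp (real n * l * V n \<omega>))) / real n) \<longlonglongrightarrow> cgf \<phi> l"
      using Lim_transform_eventually[OF log_mgf_limit[OF s(1)]] by (simp add: s(2))
  qed
  interpret scaled_cgf M V "tilts \<phi>" "cgf \<phi>" "deriv (cgf \<phi>)" by fact
  have K: "J = K_fun \<phi>"
    using Legendre_cgf_eq_K_fun assms(2,3) cgf by blast
  have "x \<in> deriv (cgf \<phi>) ` tilts \<phi>" if "J x \<noteq> \<infinity>" for x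
  proof -
    have "0 < x"
      using that by (simp add: K K_fun_def split: if_splits)
    then obtain s where "admissible \<phi> s" "x = mean \<phi> s"
      using mean_surj[OF assms(2,3)] by blast
    then show ?thesis
      using tilt_in_tilts deriv_cgf_tilt by (metis image_eqI)
  qed
  then have "satisfies_LDP M V (K_fun \<phi>)"
    using Gaertner_Ellis unfolding K by blast
  then show ?thesis
    using good_rate_function_J unfolding K V_def[abs_def] by blast
qed

end
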